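(* Let $\mathcal{C}$ be a locally left-Gaussian category, with a chosen finite generating set of morphisms $\mathcal{A}$ and chosen linear orderings on the sets $\mathcal{A}(-,x)$. The associated complex $(C_*,\partial_* )$ (augmented by $\partial_0:C_0\to\mathbb{Z}$) is a free resolution of the trivial $\mathbb{Z}\mathcal{C}$-module $\mathbb{Z}$.
   Context: Categories are small, and the composite of $f:x\to y$, $g:y\to z$ is written $fg$. A $\mathbb{Z}\mathcal{C}$-module is a contravariant functor $M$ from $\mathcal{C}$ to abelian groups ($f:x\to y$ acts as $M_y\to M_x$, $a\mapsto f.a$); morphisms are natural transformations. The trivial module $\mathbb{Z}$ sends every object to $\mathbb{Z}$ and every morphism to the identity. The free $\mathbb{Z}\mathcal{C}$-module on a family of sets $\{S_x\}_{x\in\mathrm{Ob}(\mathcal{C})}$ has as value at $x$ the free abelian group on the pairs $(g,s)$, written $gs$, with $g\in\mathcal{C}(x,y)$, $s\in S_y$, and $f.(gs)=(fg)s$. Divisibility. The category $\mathcal{C}$ is assumed to have no nontrivial invertible morphism. For morphisms $f,g$ with the same source, write $f\preceq g$ if $fh=g$ for some $h$. If $g=hf$, then $f$ right-divides $g$ and $g$ is a left-multiple of $f$. $\mathcal{C}$ is right-Noetherian if the relation $\preceq$ admits no infinite strictly descending chain. A left-lcm of two morphisms with the same target is a common left-multiple that right-divides every common left-multiple. $\mathcal{C}$ is locally left-Gaussian if it is right-cancellative ($gf=g'f\Rightarrow g=g'$), right-Noetherian, and any two morphisms having a common left-multiple have a left-lcm. Left-lcms of finite families are denoted $\operatorname{lcm}$.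 Cells. Fix a finite set $\mathcal{A}$ of morphisms which generates $\mathcal{C}$ and, for each object $x$, a linear order $<$ on the set $\mathcal{A}(-,x)$ of elements of $\mathcal{A}$ with target $x$. For a morphism $f$, $\operatorname{md}(f)$ is the $<$-least right-divisor of $f$ in $\mathcal{A}$. An $n$-cell is an $n$-tuple $[\alpha_1,\dots,\alpha_n]$ of elements of $\mathcal{A}$ with the same target such that $\alpha_1<\dots<\alpha_n$ and $\alpha_i=\operatorname{md}(\operatorname{lcm}(\alpha_i,\dots,\alpha_n))$ for all $i$ (in particular these lcms exist); its source is the source of $\operatorname{lcm}(\alpha_1,\dots,\alpha_n)$. For $n=0$ there is one cell $[\varnothing]_x$ for each object $x$, with source $x$ and $\operatorname{lcm}=1_x$. $C_n$ is the free $\mathbb{Z}\mathcal{C}$-module on the family (indexed by objects $x$) of the sets of $n$-cells with source $x$. An elementary $n$-chain is $f[A]$ with $[A]$ an $n$-cell and the target of $f$ equal to the source of $[A]$. Let $A_1$ be the first entry of a nonempty $A$. The chain $f[A]$ is irreducible if either $f[A]=1_x[\varnothing]_x$, or $A$ is nonempty and $A_1=\operatorname{md}(f\operatorname{lcm}(A))$; otherwise it is reducible. For an $(n+1)$-cell $[\alpha,A]$ ($\alpha$ followed by the entries of $A$), $\alpha_{/A}$ is defined by $\alpha_{/A}\operatorname{lcm}(A)=\operatorname{lcm}(\alpha,A)$. Differential. The $\mathbb{Z}\mathcal{C}$-linear maps $\partial_n:C_n\to C_{n-1}$ (with $C_{-1}:=\mathbb{Z}$) and the source-preserving $\mathbb{Z}$-linear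 maps $s_n:C_n\to C_{n+1}$, $r_n:=s_{n-1}\circ\partial_n$ are defined inductively by: $\partial_0([\varnothing]_x)=1$; $s_{-1}(1)=[\varnothing]_x$ at the object $x$; and for $n\geqslant 0$, $\partial_{n+1}([\alpha,A])=\alpha_{/A}[A]-r_n(\alpha_{/A}[A])$; $s_n(f[A])=0$ if $f[A]$ is irreducible; and $s_n(f[A])=g[\alpha,A]+s_n(g\,r_n(\alpha_{/A}[A]))$ otherwise, where $\alpha=\operatorname{md}(f\operatorname{lcm}(A))$ and $f=g\alpha_{/A}$.
   Formalization: The generating set is assumed to contain no identities, and "strictly descending" in right-Noetherian means proper divisibility (fh = g with h not an identity), so fh = f with h nontrivial is excluded; without these the claim fails. *)

theory Defs
  imports "HOL-Algebra.Free_Abelian_Groups"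
begin

section \<open>Small categories\<close>

record ('o, 'm) small_cat =
  Obj :: "'o set"
  Mor :: "'m set"
  src :: "'m \<Rightarrow> 'o"
  tgt :: "'m \<Rightarrow> 'o"
  idt :: "'o \<Rightarrow> 'm"
  cmp :: "'m \<Rightarrow> 'm \<Rightarrow> 'm"  \<comment> \<open>diagrammatic order: \<open>cmp f g\<close> is \<open>f\<close> followed by \<open>g\<close>\<close>

locale category =
  fixes C :: "('o, 'm) small_cat"
  assumes src_in: "f \<in> Mor C \<Longrightarrow> src C f \<in> Obj C"
    and tgt_in: "f \<in> Mor C \<Longrightarrow> tgt C f \<in> Obj C"
    and idt_in: "x \<in> Obj C \<Longrightarrow> idt C x \<in> Mor C"
    and src_idt: "x \<in> Obj C \<Longrightarrow> src C (idt C x) = x"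
    and tgt_idt: "x \<in> Obj C \<Longrightarrow> tgt C (idt C x) = x"
    and cmp_in: "\<lbrakk>f \<in> Mor C; g \<in> Mor C; tgt C f = src C g\<rbrakk> \<Longrightarrow> cmp C f g \<in> Mor C"
    and src_cmp: "\<lbrakk>f \<in> Mor C; g \<in> Mor C; tgt C f = src C g\<rbrakk> \<Longrightarrow> src C (cmp C f g) = src C f"
    and tgt_cmp: "\<lbrakk>f \<in> Mor C; g \<in> Mor C; tgt C f = src C g\<rbrakk> \<Longrightarrow> tgt C (cmp C f g) = tgt C g"
    and cmp_idt_left: "f \<in> Mor C \<Longrightarrow> cmp C (idt C (src C f)) f = f"
    and cmp_idt_right: "f \<in> Mor C \<Longrightarrow> cmp C f (idt C (tgt C f)) = f"
    and cmp_assoc: "\<lbrakk>f \<in> Mor C; g \<in> Mor C; h \<in> Mor C; tgt C f = src C g; tgt C g = src C h\<rbrakk>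
      \<Longrightarrow> cmp C (cmp C f g) h = cmp C f (cmp C g h)"

definition identity_mor :: "('o, 'm) small_cat \<Rightarrow> 'm \<Rightarrow> bool"
  where "identity_mor C f \<longleftrightarrow> (\<exists>x\<in>Obj C. f = idt C x)"

definition invertible_mor :: "('o, 'm) small_cat \<Rightarrow> 'm \<Rightarrow> bool"
  where "invertible_mor C f \<longleftrightarrow> f \<in> Mor C \<and>
    (\<exists>g\<in>Mor C. src C g = tgt C f \<and> tgt C g = src C f \<and>
       cmp C f g = idt C (src C f) \<and> cmp C g f = idt C (tgt C f))"

inductive_set generated :: "('o, 'm) small_cat \<Rightarrow> 'm set \<Rightarrow> 'm set"
  for C :: "('o, 'm) small_cat" and A :: "'m set" where
  generated_idt: "x \<in> Obj C \<Longrightarrow> idt C x \<in> generated C A"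
| generated_cmp: "\<lbrakk>a \<in> A; g \<in> generated C A; tgt C a = src C g\<rbrakk> \<Longrightarrow> cmp C a g \<in> generated C A"

section \<open>Divisibility\<close>

definition right_divides :: "('o, 'm) small_cat \<Rightarrow> 'm \<Rightarrow> 'm \<Rightarrow> bool"
  where "right_divides C f g \<longleftrightarrow> f \<in> Mor C \<and>
    (\<exists>h\<in>Mor C. tgt C h = src C f \<and> g = cmp C h f)"

definition right_cancellative :: "('o, 'm) small_cat \<Rightarrow> bool"
  where "right_cancellative C \<longleftrightarrow>
    (\<forall>f\<in>Mor C. \<forall>g\<in>Mor C. \<forall>g'\<in>Mor C. tgt C g = src C f \<longrightarrow> tgt C g' = src C f \<longrightarrow>
       cmp C g f = cmp C g' f \<longrightarrow> g = g')"

text \<open>The strict part of left-divisibility: the quotient is not an identity. Without left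
  cancellation this is not the same as \<open>f\<close> left-dividing \<open>g\<close> with \<open>f \<noteq> g\<close>: a loop \<open>f = f h\<close> with
  \<open>h\<close> not an identity is a strict step here, hence excluded by right-Noetherianity.\<close>

definition strictly_left_divides :: "('o, 'm) small_cat \<Rightarrow> 'm \<Rightarrow> 'm \<Rightarrow> bool"
  where "strictly_left_divides C f g \<longleftrightarrow> f \<in> Mor C \<and>
    (\<exists>h\<in>Mor C. \<not> identity_mor C h \<and> tgt C f = src C h \<and> cmp C f h = g)"

definition right_Noetherian :: "('o, 'm) small_cat \<Rightarrow> bool"
  where "right_Noetherian C \<longleftrightarrow>
    \<not> (\<exists>F :: nat \<Rightarrow> 'm. (\<forall>i. F i \<in> Mor C) \<and> (\<forall>i. strictly_left_divides C (F (Suc i)) (F i)))"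

definition is_left_lcm :: "('o, 'm) small_cat \<Rightarrow> 'm set \<Rightarrow> 'm \<Rightarrow> bool"
  where "is_left_lcm C B m \<longleftrightarrow> m \<in> Mor C \<and> (\<forall>b\<in>B. right_divides C b m) \<and>
    (\<forall>m'\<in>Mor C. (\<forall>b\<in>B. right_divides C b m') \<longrightarrow> right_divides C m m')"

definition locally_left_Gaussian :: "('o, 'm) small_cat \<Rightarrow> bool"
  where "locally_left_Gaussian C \<longleftrightarrow> right_cancellative C \<and> right_Noetherian C \<and>
    (\<forall>f\<in>Mor C. \<forall>g\<in>Mor C. tgt C f = tgt C g \<longrightarrow>
       (\<exists>m\<in>Mor C. right_divides C f m \<and> right_divides C g m) \<longrightarrow> (\<exists>m. is_left_lcm C {f, g} m))"

text \<open>Left-lcms of nonempty finite sets, and the right quotient \<open>g\<close> in \<open>g h = f\<close>, are unique in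
  right-cancellative categories without nontrivial invertible morphisms.\<close>

definition left_lcm :: "('o, 'm) small_cat \<Rightarrow> 'm set \<Rightarrow> 'm"
  where "left_lcm C B = (THE m. is_left_lcm C B m)"

definition right_quot :: "('o, 'm) small_cat \<Rightarrow> 'm \<Rightarrow> 'm \<Rightarrow> 'm"
  where "right_quot C f h = (THE g. g \<in> Mor C \<and> tgt C g = src C h \<and> cmp C g h = f)"

section \<open>Modules over a category\<close>

text \<open>Abelian groups are written multiplicatively, as in HOL-Algebra.\<close>

record ('o, 'm, 'a) cat_module =
  val :: "'o \<Rightarrow> 'a monoid"
  act :: "'m \<Rightarrow> 'a \<Rightarrow> 'a"

definition is_cat_module :: "('o, 'm) small_cat \<Rightarrow> ('o, 'm, 'a) cat_module \<Rightarrow> bool"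
  where "is_cat_module C M \<longleftrightarrow>
    (\<forall>x\<in>Obj C. comm_group (val M x)) \<and>
    (\<forall>f\<in>Mor C. act M f \<in> hom (val M (tgt C f)) (val M (src C f))) \<and>
    (\<forall>x\<in>Obj C. \<forall>a\<in>carrier (val M x). act M (idt C x) a = a) \<and>
    (\<forall>f\<in>Mor C. \<forall>g\<in>Mor C. tgt C f = src C g \<longrightarrow>
       (\<forall>a\<in>carrier (val M (tgt C g)). act M (cmp C f g) a = act M f (act M g a)))"

definition module_hom :: "('o, 'm) small_cat \<Rightarrow> ('o, 'm, 'a) cat_module \<Rightarrow> ('o, 'm, 'b) cat_module
    \<Rightarrow> ('o \<Rightarrow> 'a \<Rightarrow> 'b) \<Rightarrow> bool"
  where "module_hom C M N \<phi> \<longleftrightarrow>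
    (\<forall>x\<in>Obj C. \<phi> x \<in> hom (val M x) (val N x)) \<and>
    (\<forall>f\<in>Mor C. \<forall>a\<in>carrier (val M (tgt C f)).
       \<phi> (src C f) (act M f a) = act N f (\<phi> (tgt C f) a))"

definition module_iso :: "('o, 'm) small_cat \<Rightarrow> ('o, 'm, 'a) cat_module \<Rightarrow> ('o, 'm, 'b) cat_module
    \<Rightarrow> ('o \<Rightarrow> 'a \<Rightarrow> 'b) \<Rightarrow> bool"
  where "module_iso C M N \<phi> \<longleftrightarrow> module_hom C M N \<phi> \<and>
    (\<forall>x\<in>Obj C. bij_betw (\<phi> x) (carrier (val M x)) (carrier (val N x)))"

definition trivial_module :: "('o, 'm, int) cat_module"
  where "trivial_module = \<lparr>val = (\<lambda>x. integer_group), act = (\<lambda>f a. a)\<rparr>"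

definition free_module :: "('o, 'm) small_cat \<Rightarrow> ('o \<Rightarrow> 's set)
    \<Rightarrow> ('o, 'm, ('m \<times> 's) \<Rightarrow>\<^sub>0 int) cat_module"
  where "free_module C S =
    \<lparr>val = (\<lambda>x. free_Abelian_group {(g, s). g \<in> Mor C \<and> src C g = x \<and> s \<in> S (tgt C g)}),
     act = (\<lambda>f. frag_extend (\<lambda>(g, s). frag_of (cmp C f g, s)))\<rparr>"

text \<open>Letting the basis range over families of sets of module elements is no restriction: an
  isomorphism from a free module embeds its basis into the module.\<close>

definition is_free_module :: "('o, 'm) small_cat \<Rightarrow> ('o, 'm, 'a) cat_module \<Rightarrow> bool"
  where "is_free_module C M \<longleftrightarrow>
    (\<exists>(S :: 'o \<Rightarrow> 'a set) \<phi>. module_iso C (free_module C S) M \<phi>)"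

text \<open>\<open>\<cdots> \<rightarrow> P 2 \<rightarrow> P 1 \<rightarrow> P 0 \<rightarrow> M \<rightarrow> 0\<close>, where \<open>d n\<close> goes from \<open>P (n + 1)\<close> to \<open>P n\<close> and
  \<open>\<epsilon>\<close> from \<open>P 0\<close> to \<open>M\<close>, so that \<open>d n\<close> is the differential of degree \<open>n + 1\<close>.\<close>

definition free_resolution :: "('o, 'm) small_cat \<Rightarrow> ('o, 'm, 'b) cat_module
    \<Rightarrow> (nat \<Rightarrow> ('o, 'm, 'a) cat_module) \<Rightarrow> ('o \<Rightarrow> 'a \<Rightarrow> 'b) \<Rightarrow> (nat \<Rightarrow> 'o \<Rightarrow> 'a \<Rightarrow> 'a) \<Rightarrow> bool"
  where "free_resolution C M P \<epsilon> d \<longleftrightarrow>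
    is_cat_module C M \<and>
    (\<forall>n. is_cat_module C (P n) \<and> is_free_module C (P n)) \<and>
    module_hom C (P 0) M \<epsilon> \<and>
    (\<forall>n. module_hom C (P (Suc n)) (P n) (d n)) \<and>
    (\<forall>x\<in>Obj C. \<epsilon> x ` carrier (val (P 0) x) = carrier (val M x)) \<and>
    (\<forall>x\<in>Obj C. d 0 x ` carrier (val (P (Suc 0)) x) = kernel (val (P 0) x) (val M x) (\<epsilon> x)) \<and>
    (\<forall>n. \<forall>x\<in>Obj C. d (Suc n) x ` carrier (val (P (Suc (Suc n))) x) =
       kernel (val (P (Suc n)) x) (val (P n) x) (d n x))"

section \<open>Cells\<close>

text \<open>\<open>lt x\<close> is the strict linear order on the elements of \<open>A\<close> with target \<open>x\<close>. Identities are
  not generators: an identity \<open>1\<close> in \<open>A\<close> yields either a \<open>1\<close>-cell \<open>[1]\<close> that is a nonbounding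
  cycle, or (if \<open>1\<close> is the least element) \<open>md f = 1\<close> for every \<open>f\<close> into that object.\<close>

definition ordered_generators :: "('o, 'm) small_cat \<Rightarrow> 'm set \<Rightarrow> ('o \<Rightarrow> 'm rel) \<Rightarrow> bool"
  where "ordered_generators C A lt \<longleftrightarrow>
    finite A \<and> A \<subseteq> Mor C \<and> (\<forall>a\<in>A. \<not> identity_mor C a) \<and> generated C A = Mor C \<and>
    (\<forall>x\<in>Obj C. strict_linear_order_on {a \<in> A. tgt C a = x} (lt x))"

definition md :: "('o, 'm) small_cat \<Rightarrow> 'm set \<Rightarrow> ('o \<Rightarrow> 'm rel) \<Rightarrow> 'm \<Rightarrow> 'm"
  where "md C A lt f = (THE a. a \<in> A \<and> right_divides C a f \<and>
    (\<forall>b\<in>A. right_divides C b f \<longrightarrow> b = a \<or> (a, b) \<in> lt (tgt C f)))"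

text \<open>A cell is stored together with the common target of its entries, so that the \<open>0\<close>-cell
  \<open>[\<emptyset>]\<^sub>x\<close> is \<open>(x, [])\<close>. For nonempty cells the first component is redundant.\<close>

type_synonym ('o, 'm) cell = "'o \<times> 'm list"

fun cell_lcm :: "('o, 'm) small_cat \<Rightarrow> ('o, 'm) cell \<Rightarrow> 'm"
  where "cell_lcm C (y, as) = (if as = [] then idt C y else left_lcm C (set as))"

fun is_cell :: "('o, 'm) small_cat \<Rightarrow> 'm set \<Rightarrow> ('o \<Rightarrow> 'm rel) \<Rightarrow> ('o, 'm) cell \<Rightarrow> bool"
  where "is_cell C A lt (y, as) \<longleftrightarrow>
    y \<in> Obj C \<and> set as \<subseteq> {a \<in> A. tgt C a = y} \<and> sorted_wrt (\<lambda>a b. (a, b) \<in> lt y) as \<and>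
    (\<forall>i < length as. (\<exists>m. is_left_lcm C (set (drop i as)) m) \<and>
       as ! i = md C A lt (left_lcm C (set (drop i as))))"

definition cells :: "('o, 'm) small_cat \<Rightarrow> 'm set \<Rightarrow> ('o \<Rightarrow> 'm rel) \<Rightarrow> nat \<Rightarrow> 'o \<Rightarrow> ('o, 'm) cell set"
  where "cells C A lt n x =
    {c. is_cell C A lt c \<and> length (snd c) = n \<and> src C (cell_lcm C c) = x}"

section \<open>The chain complex\<close>

type_synonym ('o, 'm) chain = "('m \<times> ('o, 'm) cell) \<Rightarrow>\<^sub>0 int"

definition chain_module :: "('o, 'm) small_cat \<Rightarrow> 'm set \<Rightarrow> ('o \<Rightarrow> 'm rel) \<Rightarrow> nat
    \<Rightarrow> ('o, 'm, ('o, 'm) chain) cat_module"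
  where "chain_module C A lt n = free_module C (cells C A lt n)"

fun irreducible_chain :: "('o, 'm) small_cat \<Rightarrow> 'm set \<Rightarrow> ('o \<Rightarrow> 'm rel) \<Rightarrow> 'm \<Rightarrow> ('o, 'm) cell \<Rightarrow> bool"
  where "irreducible_chain C A lt f (y, as) \<longleftrightarrow>
    (if as = [] then f = idt C y else hd as = md C A lt (cmp C f (cell_lcm C (y, as))))"

text \<open>\<open>cell_quot C \<alpha> (y, A)\<close> is \<open>\<alpha>\<^bsub>/A\<^esub>\<close>.\<close>

fun cell_quot :: "('o, 'm) small_cat \<Rightarrow> 'm \<Rightarrow> ('o, 'm) cell \<Rightarrow> 'm"
  where "cell_quot C a (y, as) = right_quot C (cell_lcm C (y, a # as)) (cell_lcm C (y, as))"

text \<open>\<open>\<epsilon>\<close> is the differential of degree \<open>0\<close>, \<open>d n\<close> the one of degree \<open>n + 1\<close>, and \<open>sm\<close> the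
  contracting map of degree \<open>-1\<close>; \<open>sm x\<close>, \<open>s n x\<close> and \<open>reduction \<epsilon> d sm s n x\<close> are the
  components at the object \<open>x\<close>.\<close>

fun reduction :: "('o \<Rightarrow> 'a \<Rightarrow> int) \<Rightarrow> (nat \<Rightarrow> 'o \<Rightarrow> 'a \<Rightarrow> 'a) \<Rightarrow> ('o \<Rightarrow> int \<Rightarrow> 'a) \<Rightarrow> (nat \<Rightarrow> 'o \<Rightarrow> 'a \<Rightarrow> 'a)
    \<Rightarrow> nat \<Rightarrow> 'o \<Rightarrow> 'a \<Rightarrow> 'a"
  where "reduction \<epsilon> d sm s 0 x c = sm x (\<epsilon> x c)"
  | "reduction \<epsilon> d sm s (Suc n) x c = s n x (d n x c)"

text \<open>The simultaneous inductive definition (Dehornoy--Lafont) of the differentials and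
  contracting maps. The recursion for \<open>s\<close> ends only because of right-Noetherianity,
  so it is rendered as its system of defining equations.\<close>

definition is_DL_differential :: "('o, 'm) small_cat \<Rightarrow> 'm set \<Rightarrow> ('o \<Rightarrow> 'm rel)
    \<Rightarrow> ('o \<Rightarrow> ('o, 'm) chain \<Rightarrow> int) \<Rightarrow> (nat \<Rightarrow> 'o \<Rightarrow> ('o, 'm) chain \<Rightarrow> ('o, 'm) chain)
    \<Rightarrow> ('o \<Rightarrow> int \<Rightarrow> ('o, 'm) chain) \<Rightarrow> (nat \<Rightarrow> 'o \<Rightarrow> ('o, 'm) chain \<Rightarrow> ('o, 'm) chain) \<Rightarrow> bool"
  where "is_DL_differential C A lt \<epsilon> d sm s \<longleftrightarrow>
    (let K = chain_module C A lt; r = reduction \<epsilon> d sm s in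
    module_hom C (K 0) trivial_module \<epsilon> \<and>
    (\<forall>n. module_hom C (K (Suc n)) (K n) (d n)) \<and>
    (\<forall>x\<in>Obj C. sm x \<in> hom integer_group (val (K 0) x)) \<and>
    (\<forall>n. \<forall>x\<in>Obj C. s n x \<in> hom (val (K n) x) (val (K (Suc n)) x)) \<and>
    (\<forall>x\<in>Obj C. \<epsilon> x (frag_of (idt C x, (x, []))) = 1) \<and>
    (\<forall>x\<in>Obj C. sm x 1 = frag_of (idt C x, (x, []))) \<and>
    (\<forall>n. \<forall>x\<in>Obj C. \<forall>y a as. (y, a # as) \<in> cells C A lt (Suc n) x \<longrightarrow>
       (let q = cell_quot C a (y, as) in
        d n x (frag_of (idt C x, (y, a # as))) =
          frag_of (q, (y, as)) - r n x (frag_of (q, (y, as))))) \<and>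
    (\<forall>n. \<forall>f\<in>Mor C. \<forall>y as. (y, as) \<in> cells C A lt n (tgt C f) \<longrightarrow>
       s n (src C f) (frag_of (f, (y, as))) =
         (if irreducible_chain C A lt f (y, as) then 0
          else let a = md C A lt (cmp C f (cell_lcm C (y, as)));
                   q = cell_quot C a (y, as);
                   g = right_quot C f q
               in frag_of (g, (y, a # as)) +
                  s n (src C f) (act (K n) g (r n (src C q) (frag_of (q, (y, as))))))))"

end

theory Submission
  imports Defs
begin

text \<open>Every chain \<open>f[A]\<close> has a total \<open>f lcm(A)\<close>. The reduction \<open>r\<^sub>n\<close> sends \<open>f[A]\<close> to a combination of
  irreducible chains whose totals left-divide that of \<open>f[A]\<close>. Hence in the equation for
  \<open>s\<^sub>n(f[A])\<close> the argument of the recursive call consists of irreducible chains, where \<open>s\<^sub>n\<close>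
  vanishes, and of chains of strictly smaller total; by right-Noetherianity the equations have a
  solution. The same well-founded induction on totals shows that \<open>s\<close> is a contracting homotopy,
  \<open>\<partial>\<^sub>n\<^sub>+\<^sub>1 s\<^sub>n + r\<^sub>n = id\<close>, degree by degree: it uses that \<open>r\<^sub>n\<close> fixes irreducible chains and that
  \<open>r\<^sub>n(g r\<^sub>n(c)) = r\<^sub>n(g c)\<close>, and it yields the latter identity and \<open>r\<^sub>n \<partial>\<^sub>n\<^sub>+\<^sub>1 = 0\<close> in the next step.
  Since a homomorphism from a free abelian group is determined by its values on the basis, all of
  this takes place on elementary chains.\<close>

section \<open>Divisibility in locally left-Gaussian categories\<close>

text \<open>Non-strict companion of \<open>strictly_left_divides\<close>, by which totals are
  compared; \<open>left_divides_cases\<close> splits it into equality and a strict step.\<close>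

definition left_divides :: "('o, 'm) small_cat \<Rightarrow> 'm \<Rightarrow> 'm \<Rightarrow> bool"
  where "left_divides C f g \<longleftrightarrow> f \<in> Mor C \<and> (\<exists>h\<in>Mor C. tgt C f = src C h \<and> cmp C f h = g)"

locale ordered_Gaussian = category C
  for C :: "('o, 'm) small_cat" +
  fixes A :: "'m set" and lt :: "'o \<Rightarrow> 'm rel"
  assumes no_invertible: "invertible_mor C f \<Longrightarrow> identity_mor C f"
    and Gaussian: "locally_left_Gaussian C"
    and generators: "ordered_generators C A lt"
begin

lemmas cat_simps [simp] = src_in tgt_in idt_in src_idt tgt_idt cmp_in src_cmp tgt_cmp
  cmp_idt_left cmp_idt_right cmp_assoc

lemma cmp_right_cancel:
  assumes "cmp C g f = cmp C g' f" "f \<in> Mor C" "g \<in> Mor C" "g' \<in> Mor C"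
    "tgt C g = src C f" "tgt C g' = src C f"
  shows "g = g'"
  using assms Gaussian unfolding locally_left_Gaussian_def right_cancellative_def by blast

lemma exists_left_lcm:
  assumes "right_divides C f m" "right_divides C g m" "f \<in> Mor C" "g \<in> Mor C" "m \<in> Mor C"
    "tgt C f = tgt C g"
  shows "\<exists>l. is_left_lcm C {f, g} l"
  using assms Gaussian unfolding locally_left_Gaussian_def by metis

lemma gen_not_identity: "a \<in> A \<Longrightarrow> \<not> identity_mor C a"
  using generators by (auto simp: ordered_generators_def)

lemma lt_trans: "x \<in> Obj C \<Longrightarrow> trans (lt x)"
  and lt_irrefl: "x \<in> Obj C \<Longrightarrow> irrefl (lt x)"
  and lt_total: "x \<in> Obj C \<Longrightarrow> total_on {a \<in> A. tgt C a = x} (lt x)"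
  using generators by (auto simp: ordered_generators_def strict_linear_order_on_def)

lemma cmp_idt_idt [simp]: "x \<in> Obj C \<Longrightarrow> cmp C (idt C x) (idt C x) = idt C x"
  using cmp_idt_right[of "idt C x"] by simp

section \<open>Right-divisibility as a partial order\<close>

lemma right_divides_refl: "f \<in> Mor C \<Longrightarrow> right_divides C f f"
  unfolding right_divides_def by (metis cmp_idt_left idt_in src_in tgt_idt)

lemma right_dividesD:
  "right_divides C f g \<Longrightarrow> f \<in> Mor C \<and> g \<in> Mor C \<and> tgt C g = tgt C f"
  unfolding right_divides_def by auto

lemma right_divides_trans:
  assumes "right_divides C f g" "right_divides C g h"
  shows "right_divides C f h"
proof -
  obtain u v where uv: "u \<in> Mor C" "tgt C u = src C f" "g = cmp C u f"
    "v \<in> Mor C" "tgt C v = src C g" "h = cmp C v g" "f \<in> Mor C"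
    using assms unfolding right_divides_def by blast
  then have "cmp C v u \<in> Mor C" "tgt C (cmp C v u) = src C f" "h = cmp C (cmp C v u) f"
    by auto
  with uv(7) show ?thesis
    unfolding right_divides_def by blast
qed

lemma right_divides_cmp:
  "right_divides C f g \<Longrightarrow> h \<in> Mor C \<Longrightarrow> tgt C h = src C g \<Longrightarrow> right_divides C f (cmp C h g)"
  using right_divides_trans right_dividesD unfolding right_divides_def by blast

text \<open>If \<open>f g\<close> is an identity, then \<open>(g f) g = g (f g) = g\<close>, and
  cancelling \<open>g\<close> shows that \<open>g f\<close> is an identity too. So \<open>f\<close>
  and \<open>g\<close> are mutually inverse and \<open>no_invertible\<close> applies.\<close>

lemma cmp_identityD:
  assumes "f \<in> Mor C" "g \<in> Mor C" "tgt C f = src C g" "identity_mor C (cmp C f g)"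
  shows "identity_mor C f \<and> identity_mor C g"
proof -
  obtain x where x: "x \<in> Obj C" "cmp C f g = idt C x"
    using assms(4) unfolding identity_mor_def by blast
  then have s: "src C f = x" "tgt C g = x"
    by (metis assms(1-3) src_cmp src_idt, metis assms(1-3) tgt_cmp tgt_idt x)
  have "cmp C (cmp C g f) g = cmp C (idt C (src C g)) g"
    using assms s x by (metis cmp_assoc cmp_idt_left cmp_idt_right)
  then have "cmp C g f = idt C (src C g)"
    by (rule cmp_right_cancel) (use assms s in auto)
  then have "invertible_mor C f" "invertible_mor C g"
    unfolding invertible_mor_def using assms s x by metis+
  then show ?thesis
    using no_invertible by blast
qed

text \<open>Cancelling \<open>f\<close> in \<open>f = v u f\<close> makes \<open>v u\<close> an
  identity, hence \<open>u\<close> as well. This is the uniqueness behind the \<open>THE\<close> in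
  \<open>left_lcm\<close>.\<close>

lemma right_divides_antisym:
  assumes "right_divides C f g" "right_divides C g f"
  shows "f = g"
proof -
  obtain u v where uv: "u \<in> Mor C" "tgt C u = src C f" "g = cmp C u f"
    "v \<in> Mor C" "tgt C v = src C g" "f = cmp C v g" "f \<in> Mor C" "g \<in> Mor C"
    using assms unfolding right_divides_def by blast
  have t: "tgt C v = src C u" "src C v = src C f"
    using uv by (metis src_cmp)+
  have "cmp C (cmp C v u) f = cmp C (idt C (src C f)) f"
    using uv t by (metis cmp_assoc cmp_idt_left)
  then have "cmp C v u = idt C (src C f)"
    by (rule cmp_right_cancel) (simp_all add: uv(1,2,4,7) t)
  then have "identity_mor C u"
    using cmp_identityD[of v u] uv(1,4,7) t(1) src_in unfolding identity_mor_def by blast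
  then obtain x where "x \<in> Obj C" "u = idt C x"
    unfolding identity_mor_def by blast
  with uv show ?thesis
    by (metis cmp_idt_left tgt_idt)
qed

lemma left_lcm_eq: "is_left_lcm C B m \<Longrightarrow> left_lcm C B = m"
  unfolding left_lcm_def
  by (rule the_equality) (auto simp: is_left_lcm_def intro!: right_divides_antisym)

lemma right_quot_eq:
  assumes "g \<in> Mor C" "h \<in> Mor C" "tgt C g = src C h"
  shows "right_quot C (cmp C g h) h = g"
  unfolding right_quot_def
  by (rule the_equality) (use assms in simp, use assms cmp_right_cancel in blast)

section \<open>The least generator dividing a morphism\<close>

text \<open>\<open>generated\<close> prepends generators, so the divisor sits at the far end of the
  word: it comes from \<open>g\<close> by induction, or is \<open>a\<close> itself when
  \<open>g\<close> is an identity.\<close>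

lemma exists_gen_right_divides:
  assumes "f \<in> Mor C" "\<not> identity_mor C f"
  shows "\<exists>a\<in>A. right_divides C a f"
proof -
  have "f \<in> generated C A"
    using assms generators by (auto simp: ordered_generators_def)
  then show ?thesis
    using assms(2)
  proof induction
    case (generated_idt x)
    then show ?case by (auto simp: identity_mor_def)
  next
    case (generated_cmp a g)
    have m: "a \<in> Mor C" "g \<in> Mor C"
      using generated_cmp generators by (auto simp: ordered_generators_def)
    show ?case
    proof (cases "identity_mor C g")
      case True
      then have "cmp C a g = a"
        using m generated_cmp(3) by (metis cmp_idt_right identity_mor_def src_idt)
      then show ?thesis
        using generated_cmp m right_divides_refl by auto
    next
      case False
      then show ?thesis
        using generated_cmp m right_divides_cmp by blast
    qed
  qed
qed

lemma md_eq:
  assumes "a \<in> A" "right_divides C a f"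
    and least: "\<And>b. b \<in> A \<Longrightarrow> right_divides C b f \<Longrightarrow> b = a \<or> (a, b) \<in> lt (tgt C f)"
  shows "md C A lt f = a"
  unfolding md_def
proof (rule the_equality)
  fix b
  assume b: "b \<in> A \<and> right_divides C b f \<and>
    (\<forall>c\<in>A. right_divides C c f \<longrightarrow> c = b \<or> (b, c) \<in> lt (tgt C f))"
  have "tgt C f \<in> Obj C"
    using assms(2) right_dividesD by auto
  then have "trans (lt (tgt C f))" "irrefl (lt (tgt C f))"
    by (auto intro: lt_trans lt_irrefl)
  with b assms show "b = a"
    by (metis irrefl_def transD)
qed (use assms in auto)

lemma finite_total_has_least:
  assumes "finite S" "S \<noteq> {}" "trans r" "total_on S r"
  shows "\<exists>a\<in>S. \<forall>b\<in>S. b = a \<or> (a, b) \<in> r"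
  using assms
proof (induction S rule: finite_ne_induct)
  case (insert x S)
  then obtain a where a: "a \<in> S" "\<forall>b\<in>S. b = a \<or> (a, b) \<in> r"
    by (auto simp: total_on_def)
  have "(x, a) \<in> r \<or> (a, x) \<in> r"
    using insert a by (auto simp: total_on_def)
  then show ?case
    using a insert.prems by (metis insert_iff transD)
qed auto

lemma md_props:
  assumes f: "f \<in> Mor C" "\<not> identity_mor C f"
  shows md_gen: "md C A lt f \<in> A"
    and md_right_divides: "right_divides C (md C A lt f) f"
    and md_least: "b \<in> A \<Longrightarrow> right_divides C b f \<Longrightarrow>
      b = md C A lt f \<or> (md C A lt f, b) \<in> lt (tgt C f)"
proof -
  let ?S = "{a \<in> A. right_divides C a f}"
  have "finite ?S" "?S \<noteq> {}"
    using generators exists_gen_right_divides[OF f] by (auto simp: ordered_generators_def)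
  moreover have "total_on ?S (lt (tgt C f))"
    using lt_total[of "tgt C f"] f(1) right_dividesD unfolding total_on_def
    by (smt (verit, best) mem_Collect_eq tgt_in)
  ultimately obtain a where "a \<in> ?S" "\<forall>b\<in>?S. b = a \<or> (a, b) \<in> lt (tgt C f)"
    using finite_total_has_least lt_trans[OF tgt_in[OF f(1)]] by blast
  moreover from this have "md C A lt f = a"
    by (intro md_eq) auto
  ultimately show "md C A lt f \<in> A" "right_divides C (md C A lt f) f"
    "b \<in> A \<Longrightarrow> right_divides C b f \<Longrightarrow> b = md C A lt f \<or> (md C A lt f, b) \<in> lt (tgt C f)"
    by auto
qed

text \<open>Generators dividing \<open>m\<close> also divide \<open>F\<close>, so the least one for
  \<open>F\<close> stays least for \<open>m\<close> as long as it divides \<open>m\<close>. This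
  passes from a total to the lcm of a new cell in \<open>chain_step_up\<close>.\<close>

lemma md_right_divides_mono:
  assumes "right_divides C m F" "right_divides C (md C A lt F) m" "md C A lt F \<in> A"
    "\<not> identity_mor C F"
  shows "md C A lt m = md C A lt F"
proof (rule md_eq)
  fix b assume "b \<in> A" "right_divides C b m"
  then have "b = md C A lt F \<or> (md C A lt F, b) \<in> lt (tgt C F)"
    using assms right_divides_trans right_dividesD md_least by blast
  then show "b = md C A lt F \<or> (md C A lt F, b) \<in> lt (tgt C m)"
    using right_dividesD[OF assms(1)] by auto
qed (use assms in auto)

lemma not_identity_if_gen_right_divides:
  assumes "a \<in> A" "right_divides C a f"
  shows "\<not> identity_mor C f"
  using assms gen_not_identity cmp_identityD unfolding right_divides_def by blast

section \<open>Left-divisibility and well-foundedness\<close>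

lemma left_divides_refl: "f \<in> Mor C \<Longrightarrow> left_divides C f f"
  unfolding left_divides_def using cmp_idt_right by (metis idt_in src_idt tgt_in)

lemma left_dividesD: "left_divides C f g \<Longrightarrow> f \<in> Mor C \<and> g \<in> Mor C \<and> src C g = src C f"
  unfolding left_divides_def by auto

lemma left_divides_trans:
  assumes "left_divides C f g" "left_divides C g h"
  shows "left_divides C f h"
proof -
  obtain u v where uv: "u \<in> Mor C" "tgt C f = src C u" "g = cmp C f u"
    "v \<in> Mor C" "tgt C g = src C v" "h = cmp C g v" "f \<in> Mor C"
    using assms unfolding left_divides_def by blast
  then have "cmp C u v \<in> Mor C" "tgt C f = src C (cmp C u v)" "h = cmp C f (cmp C u v)"
    by auto
  with uv(7) show ?thesis
    unfolding left_divides_def by blast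
qed

lemma left_divides_cmp:
  assumes "left_divides C f F" "g \<in> Mor C" "tgt C g = src C F"
  shows "left_divides C (cmp C g f) (cmp C g F)"
  using assms unfolding left_divides_def by (metis cmp_assoc cmp_in src_cmp tgt_cmp)

lemma strictly_left_divides_cmp:
  assumes "strictly_left_divides C f F" "g \<in> Mor C" "tgt C g = src C F"
  shows "strictly_left_divides C (cmp C g f) (cmp C g F)"
  using assms unfolding strictly_left_divides_def by (metis cmp_assoc cmp_in src_cmp tgt_cmp)

lemma strictly_left_divides_imp: "strictly_left_divides C f F \<Longrightarrow> left_divides C f F"
  unfolding left_divides_def strictly_left_divides_def by blast

lemma left_divides_cases:
  assumes "left_divides C f F"
  obtains "f = F" | "strictly_left_divides C f F"
  using assms unfolding left_divides_def strictly_left_divides_def identity_mor_def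
  by (metis cmp_idt_right src_idt)

lemma wf_strictly_left_divides: "wf {(f, g). strictly_left_divides C f g}"
proof -
  \<comment> \<open>Places an arbitrary descending sequence inside \<open>Mor C\<close>, as
    \<open>right_Noetherian\<close> asks.\<close>
  have "F i \<in> Mor C" if "\<forall>i. strictly_left_divides C (F (Suc i)) (F i)" for F i
    using that strictly_left_divides_imp left_dividesD by blast
  then show ?thesis
    using Gaussian unfolding wf_iff_no_infinite_down_chain locally_left_Gaussian_def
      right_Noetherian_def by (metis (mono_tags, lifting) case_prodD mem_Collect_eq)
qed

section \<open>Elementary chains\<close>

definition elem_chains :: "nat \<Rightarrow> ('m \<times> ('o, 'm) cell) set"
  where "elem_chains n = {(g, c). g \<in> Mor C \<and> c \<in> cells C A lt n (tgt C g)}"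

fun chain_total :: "'m \<times> ('o, 'm) cell \<Rightarrow> 'm"
  where "chain_total (f, c) = cmp C f (cell_lcm C c)"

abbreviation irreducible :: "'m \<times> ('o, 'm) cell \<Rightarrow> bool"
  where "irreducible p \<equiv> irreducible_chain C A lt (fst p) (snd p)"

definition chains_below :: "nat \<Rightarrow> 'm \<Rightarrow> ('m \<times> ('o, 'm) cell) set"
  where "chains_below n F = {p \<in> elem_chains n. left_divides C (chain_total p) F}"

definition irred_below :: "nat \<Rightarrow> 'm \<Rightarrow> ('m \<times> ('o, 'm) cell) set"
  where "irred_below n F = {p \<in> chains_below n F. irreducible p}"

text \<open>The condition on all suffixes becomes a recursion on the list: index 0 concerns the
  whole list, the other indices the suffixes of \<open>as\<close>. Cells can then be taken apart one
  entry at a time.\<close>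

lemma is_cell_Cons_iff:
  "is_cell C A lt (y, a # as) \<longleftrightarrow> is_cell C A lt (y, as) \<and> a \<in> A \<and> tgt C a = y \<and>
    (\<forall>b\<in>set as. (a, b) \<in> lt y) \<and> (\<exists>m. is_left_lcm C (set (a # as)) m) \<and>
    md C A lt (left_lcm C (set (a # as))) = a"
  unfolding is_cell.simps by (simp only: length_Cons All_less_Suc2) auto

declare is_cell.simps [simp del] cell_lcm.simps [simp del] cell_quot.simps [simp del]

lemma cell_lcm_Nil: "cell_lcm C (y, []) = idt C y"
  by (simp add: cell_lcm.simps)

lemma is_cell_Obj: "is_cell C A lt (y, as) \<Longrightarrow> y \<in> Obj C"
  by (simp add: is_cell.simps)

lemma cell_lcm_Cons:
  assumes "is_cell C A lt (y, a # as)"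
  shows "is_left_lcm C (set (a # as)) (cell_lcm C (y, a # as))"
    and "md C A lt (cell_lcm C (y, a # as)) = a"
  using assms left_lcm_eq by (auto simp: is_cell_Cons_iff cell_lcm.simps)

lemma cell_lcm_props:
  assumes "is_cell C A lt (y, as)"
  shows cell_lcm_in: "cell_lcm C (y, as) \<in> Mor C" and cell_lcm_tgt: "tgt C (cell_lcm C (y, as)) = y"
proof -
  have "cell_lcm C (y, as) \<in> Mor C \<and> tgt C (cell_lcm C (y, as)) = y"
  proof (cases as)
    case Nil
    then show ?thesis using assms by (simp add: cell_lcm_Nil is_cell_Obj)
  next
    case (Cons a bs)
    then have "right_divides C a (cell_lcm C (y, as))" "tgt C a = y"
      using cell_lcm_Cons(1)[of y a bs] assms by (auto simp: is_left_lcm_def is_cell_Cons_iff)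
    then show ?thesis using right_dividesD by auto
  qed
  then show "cell_lcm C (y, as) \<in> Mor C" "tgt C (cell_lcm C (y, as)) = y" by auto
qed

text \<open>The universal property of lcms, uniformly in the length. For the empty cell it says that
  an identity right-divides every morphism into \<open>y\<close>, which is where the target of
  \<open>m\<close> enters.\<close>

lemma cell_lcm_divides_iff:
  assumes "is_cell C A lt (y, as)" "m \<in> Mor C" "tgt C m = y"
  shows "right_divides C (cell_lcm C (y, as)) m \<longleftrightarrow> (\<forall>a\<in>set as. right_divides C a m)"
proof (cases as)
  case Nil
  have "right_divides C (idt C y) m"
    unfolding right_divides_def using assms by (auto intro!: bexI[of _ m])
  with Nil show ?thesis by (simp add: cell_lcm_Nil)
next
  case (Cons a bs)
  then show ?thesis
    using cell_lcm_Cons(1)[of y a bs] assms unfolding is_left_lcm_def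
    by (metis right_divides_trans)
qed

lemma is_cell_tl: "is_cell C A lt (y, a # as) \<Longrightarrow> is_cell C A lt (y, as)"
  by (simp add: is_cell_Cons_iff)

lemma elem_chainsD:
  assumes "(f, (y, as)) \<in> elem_chains n"
  shows "f \<in> Mor C" "is_cell C A lt (y, as)" "length as = n"
    "cell_lcm C (y, as) \<in> Mor C" "tgt C (cell_lcm C (y, as)) = y"
    "tgt C f = src C (cell_lcm C (y, as))"
  using assms cell_lcm_in cell_lcm_tgt unfolding elem_chains_def cells_def
  by auto

lemma elem_chainsI:
  assumes "f \<in> Mor C" "is_cell C A lt (y, as)" "length as = n" "tgt C f = src C (cell_lcm C (y, as))"
  shows "(f, (y, as)) \<in> elem_chains n"
  using assms unfolding elem_chains_def cells_def by auto

text \<open>Every entry of \<open>as\<close> right-divides the lcm of \<open>a # as\<close>, hence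
  so does their own lcm; by cancellation the quotient is the one that \<open>THE\<close>
  selects.\<close>

lemma cell_quot_props:
  assumes "is_cell C A lt (y, a # as)"
  shows cell_quot_in: "cell_quot C a (y, as) \<in> Mor C"
    and cell_quot_src: "src C (cell_quot C a (y, as)) = src C (cell_lcm C (y, a # as))"
    and cell_quot_tgt: "tgt C (cell_quot C a (y, as)) = src C (cell_lcm C (y, as))"
    and cmp_cell_quot: "cmp C (cell_quot C a (y, as)) (cell_lcm C (y, as)) = cell_lcm C (y, a # as)"
proof -
  have "right_divides C (cell_lcm C (y, as)) (cell_lcm C (y, a # as))"
    using cell_lcm_divides_iff[OF is_cell_tl[OF assms] cell_lcm_in[OF assms] cell_lcm_tgt[OF assms]]
      cell_lcm_Cons(1)[OF assms] by (auto simp: is_left_lcm_def)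
  then obtain q where q: "q \<in> Mor C" "tgt C q = src C (cell_lcm C (y, as))"
    "cell_lcm C (y, a # as) = cmp C q (cell_lcm C (y, as))"
    unfolding right_divides_def by blast
  have m: "cell_lcm C (y, as) \<in> Mor C"
    using assms is_cell_tl cell_lcm_in by blast
  have *: "cell_quot C a (y, as) = q"
    using q right_quot_eq[OF q(1) m q(2)] by (simp add: cell_quot.simps)
  show "cell_quot C a (y, as) \<in> Mor C"
    "src C (cell_quot C a (y, as)) = src C (cell_lcm C (y, a # as))"
    "tgt C (cell_quot C a (y, as)) = src C (cell_lcm C (y, as))"
    "cmp C (cell_quot C a (y, as)) (cell_lcm C (y, as)) = cell_lcm C (y, a # as)"
    unfolding * using q m by auto
qed

section \<open>Pairing reducible chains with irreducible chains one degree higher\<close>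

text \<open>The passage from \<open>f[a, A]\<close> to the leading term of its differential. It
  preserves totals, since the quotient composed with \<open>lcm(A)\<close> is
  \<open>lcm(a, A)\<close>.\<close>

lemma chain_step_down:
  assumes p: "(f, (y, a # as)) \<in> elem_chains (Suc n)"
  shows "(cell_quot C a (y, as), (y, as)) \<in> elem_chains n"
    and "(cmp C f (cell_quot C a (y, as)), (y, as)) \<in> elem_chains n"
    and "chain_total (cell_quot C a (y, as), (y, as)) = cell_lcm C (y, a # as)"
    and "chain_total (cmp C f (cell_quot C a (y, as)), (y, as)) = chain_total (f, (y, a # as))"
  using elem_chainsD[OF p] cell_quot_props[of y a as] is_cell_tl[of y a as] cell_lcm_in[of y as]
  by (auto intro!: elem_chainsI)

text \<open>The least generator dividing the common total is \<open>a\<close>. It lies strictly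
  below the first entry of \<open>A\<close>, and if \<open>A\<close> is empty it keeps the total
  from being an identity. With \<open>chain_step_up\<close> this pairs irreducible chains with
  reducible ones of the same total.\<close>

lemma irreducible_step_down:
  assumes p: "(f, (y, a # as)) \<in> elem_chains (Suc n)" and irr: "irreducible (f, (y, a # as))"
  shows "\<not> irreducible (cmp C f (cell_quot C a (y, as)), (y, as))"
proof
  let ?q = "cell_quot C a (y, as)"
  assume r: "irreducible (cmp C f ?q, (y, as))"
  note pD = elem_chainsD[OF p]
  have a: "a \<in> A" "tgt C a = y" "\<forall>b\<in>set as. (a, b) \<in> lt y" "y \<in> Obj C"
    using pD(2) by (auto simp: is_cell_Cons_iff is_cell_Obj)
  have F: "chain_total (cmp C f ?q, (y, as)) = chain_total (f, (y, a # as))"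
    using chain_step_down[OF p] by simp
  have "right_divides C a (chain_total (f, (y, a # as)))"
    using cell_lcm_Cons(1)[OF pD(2)] pD by (auto intro!: right_divides_cmp simp: is_left_lcm_def)
  then have nid: "\<not> identity_mor C (chain_total (f, (y, a # as)))"
    using a not_identity_if_gen_right_divides by blast
  show False
  proof (cases as)
    case Nil
    then have "chain_total (f, (y, a # as)) = idt C y"
      using r F a(4) cmp_idt_right[OF idt_in[OF a(4)]] by (simp add: cell_lcm_Nil)
    then show False
      using nid a(4) unfolding identity_mor_def by blast
  next
    case (Cons b bs)
    then have "b = a"
      using r irr F by simp
    then show False
      using a Cons lt_irrefl by (auto simp: irrefl_def)
  qed
qed

text \<open>The total \<open>F\<close> is a common left-multiple of \<open>a\<close> and
  \<open>lcm(A)\<close>, so these have a left-lcm \<open>m\<close>, which is the lcm of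
  \<open>a # as\<close>. Writing \<open>F = h m\<close> and cancelling \<open>lcm(A)\<close> shows
  that \<open>g\<close> is \<open>h\<close>, so the new chain still has total
  \<open>F\<close>.\<close>

lemma chain_step_up:
  assumes p: "(f, (y, as)) \<in> elem_chains n" and red: "\<not> irreducible (f, (y, as))"
  defines "a \<equiv> md C A lt (chain_total (f, (y, as)))"
  defines "q \<equiv> cell_quot C a (y, as)"
  defines "g \<equiv> right_quot C f q"
  shows "(g, (y, a # as)) \<in> elem_chains (Suc n)" and "irreducible (g, (y, a # as))"
    and "chain_total (g, (y, a # as)) = chain_total (f, (y, as))" and "cmp C g q = f"
proof -
  note pD = elem_chainsD[OF p]
  define F where "F = chain_total (f, (y, as))"
  have F: "F \<in> Mor C" "tgt C F = y"
    using pD by (auto simp: F_def)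
  \<comment> \<open>An identity as total would leave only the irreducible chain on an empty cell,
    since an entry of a nonempty cell is a generator dividing \<open>F\<close>.\<close>
  have nid: "\<not> identity_mor C F"
  proof (cases as)
    case Nil
    then show ?thesis
      using red pD src_in[of f] by (auto simp: F_def cell_lcm_Nil is_cell_Obj identity_mor_def)
  next
    case (Cons b bs)
    then have "b \<in> A" "right_divides C b F"
      using cell_lcm_Cons(1)[of y b bs] pD unfolding F_def
      by (auto intro!: right_divides_cmp simp: is_left_lcm_def is_cell_Cons_iff)
    then show ?thesis using not_identity_if_gen_right_divides by blast
  qed
  note a = md_props[OF F(1) nid, folded a_def[folded F_def]]
  have lcmF: "right_divides C (cell_lcm C (y, as)) F"
    unfolding F_def right_divides_def using pD by auto
  have "\<exists>m. is_left_lcm C {a, cell_lcm C (y, as)} m"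
    using exists_left_lcm[OF a(2) lcmF] right_dividesD[OF a(2)] right_dividesD[OF lcmF] by auto
  then obtain m where m: "is_left_lcm C {a, cell_lcm C (y, as)} m" ..
  have mM: "m \<in> Mor C" "tgt C m = y"
    using m right_dividesD[of "cell_lcm C (y, as)" m] pD(5) by (auto simp: is_left_lcm_def)
  have "is_left_lcm C (set (a # as)) m"
    unfolding is_left_lcm_def
  proof (intro conjI ballI impI)
    show "m \<in> Mor C" by (fact mM)
    show "right_divides C b m" if "b \<in> set (a # as)" for b
      using that m cell_lcm_divides_iff[OF pD(2) mM] by (auto simp: is_left_lcm_def)
    show "right_divides C m m'" if "m' \<in> Mor C" "\<forall>b\<in>set (a # as). right_divides C b m'" for m'
    proof -
      have "tgt C m' = y"
        using that right_dividesD[of a m'] right_dividesD[OF a(2)] F by auto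
      then show ?thesis
        using that m cell_lcm_divides_iff[OF pD(2) that(1)] by (auto simp: is_left_lcm_def)
    qed
  qed
  note lcm = this
  have mF: "right_divides C m F"
    using m a lcmF F by (auto simp: is_left_lcm_def)
  have mdm: "md C A lt m = a"
    using md_right_divides_mono[OF mF] a nid m by (auto simp: a_def F_def is_left_lcm_def)
  \<comment> \<open>Only the first entry \<open>c\<close> has to be compared with \<open>a\<close>:
    it divides \<open>F\<close>, so it equals or exceeds \<open>a\<close>, and equality would mean
    irreducibility. Transitivity gives the other entries.\<close>
  have lt_as: "(a, b) \<in> lt y" if b: "b \<in> set as" for b
  proof -
    obtain c bs where c: "as = c # bs"
      using b by (cases as) auto
    have "c \<in> A" "right_divides C c F"
      using c pD cell_lcm_divides_iff[OF pD(2) F] lcmF by (auto simp: is_cell_Cons_iff)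
    then have "c = a \<or> (a, c) \<in> lt y"
      using a(3) F by auto
    then have ac: "(a, c) \<in> lt y"
      using red c by (auto simp: a_def)
    show ?thesis
      using b c ac pD(2) transD[OF lt_trans[OF is_cell_Obj[OF pD(2)]] ac]
      by (auto simp: is_cell_Cons_iff)
  qed
  have cell: "is_cell C A lt (y, a # as)"
    using pD(2) lt_as a(1) right_dividesD[OF a(2)] F lcm mdm left_lcm_eq[OF lcm]
    by (auto simp: is_cell_Cons_iff)
  have mq: "cell_lcm C (y, a # as) = m"
    using left_lcm_eq[OF lcm] by (simp add: cell_lcm.simps)
  note qq = cell_quot_props[OF cell, folded q_def, unfolded mq]
  obtain h where h: "h \<in> Mor C" "tgt C h = src C m" "F = cmp C h m"
    using mF unfolding right_divides_def by blast
  \<comment> \<open>Both sides equal \<open>F\<close>; the left one because \<open>q\<close>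
    composed with \<open>lcm(A)\<close> is \<open>m\<close>.\<close>
  have "cmp C (cmp C h q) (cell_lcm C (y, as)) = cmp C f (cell_lcm C (y, as))"
    using h qq pD by (metis F_def cmp_assoc chain_total.simps)
  then have hq: "cmp C h q = f"
    by (rule cmp_right_cancel) (use h qq pD in auto)
  then have gh: "g = h"
    unfolding g_def using right_quot_eq[of h q] h qq by auto
  show "(g, (y, a # as)) \<in> elem_chains (Suc n)"
    using cell h mq gh pD by (auto intro!: elem_chainsI)
  show tot: "chain_total (g, (y, a # as)) = chain_total (f, (y, as))"
    using h gh mq by (simp add: F_def)
  show "irreducible (g, (y, a # as))"
    using tot by (simp add: a_def)
  show "cmp C g q = f"
    using hq gh by simp
qed

end

section \<open>Translates of chains\<close>

lemma frag_extend_frag_extend: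
  "frag_extend f (frag_extend g c) = frag_extend (\<lambda>p. frag_extend f (g p)) c"
  by (rule frag_induction[of c UNIV]) (auto simp: frag_extend_diff)

lemma keys_frag_extend_subset:
  assumes "Poly_Mapping.keys c \<subseteq> S" "\<And>p. p \<in> S \<Longrightarrow> Poly_Mapping.keys (f p) \<subseteq> T"
  shows "Poly_Mapping.keys (frag_extend f c) \<subseteq> T"
  using assms keys_frag_extend[of f c] by blast

lemma frag_extend_diff_fun: "frag_extend (\<lambda>p. f p - g p) c = frag_extend f c - frag_extend g c"
  by (rule frag_induction[of c UNIV]) (auto simp: frag_extend_diff)

lemma frag_extend_frag_of_id:
  assumes "\<And>p. p \<in> Poly_Mapping.keys c \<Longrightarrow> f p = frag_of p"
  shows "frag_extend f c = c"
  using frag_extend_eq[of c f frag_of] frag_expansion[of c] assms by simp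

lemma keys_diff_subset:
  assumes "Poly_Mapping.keys a \<subseteq> S" "Poly_Mapping.keys b \<subseteq> S"
  shows "Poly_Mapping.keys (a - b) \<subseteq> S"
  using keys_diff[of a b] assms by blast

lemma keys_add_subset:
  assumes "Poly_Mapping.keys a \<subseteq> S" "Poly_Mapping.keys b \<subseteq> S"
  shows "Poly_Mapping.keys (a + b) \<subseteq> S"
  using keys_add[of a b] assms by blast

text \<open>The action of a morphism on a free module. The basis type \<open>'s\<close> is kept
  general because the proof of freeness also uses bases consisting of module elements.\<close>

definition translate :: "('o, 'm) small_cat \<Rightarrow> 'm \<Rightarrow> ('m \<times> 's \<Rightarrow>\<^sub>0 int) \<Rightarrow> ('m \<times> 's \<Rightarrow>\<^sub>0 int)"
  where "translate C g = frag_extend (\<lambda>(h, s). frag_of (cmp C g h, s))"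

lemma translate_of [simp]: "translate C g (frag_of (h, s)) = frag_of (cmp C g h, s)"
  by (simp add: translate_def)

lemma translate_frag_extend:
  "translate C g (frag_extend f c) = frag_extend (\<lambda>p. translate C g (f p)) c"
  by (simp add: translate_def frag_extend_frag_extend)

lemma translate_diff: "translate C g (a - b) = translate C g a - translate C g b"
  by (simp add: translate_def frag_extend_diff)

context ordered_Gaussian
begin

section \<open>Supports bounded by a total or by a source\<close>

lemma chains_belowI: "p \<in> elem_chains n \<Longrightarrow> p \<in> chains_below n (chain_total p)"
  by (cases p) (auto simp: chains_below_def elem_chainsD intro!: left_divides_refl)

lemma irred_below_mono: "left_divides C F G \<Longrightarrow> irred_below n F \<subseteq> irred_below n G"
  by (auto simp: chains_below_def irred_below_def intro: left_divides_trans)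

lemma irred_below_subset: "irred_below n F \<subseteq> chains_below n F"
  by (auto simp: irred_below_def)

lemma chains_below_subset: "chains_below n F \<subseteq> elem_chains n"
  by (auto simp: chains_below_def)

lemma chains_below_src:
  "(h, c) \<in> chains_below n F \<Longrightarrow> h \<in> Mor C \<and> src C h = src C F"
  by (cases c) (auto simp: chains_below_def elem_chainsD dest!: left_dividesD)

lemma chain_total_cmp:
  assumes "(h, c) \<in> elem_chains n" "g \<in> Mor C" "tgt C g = src C h"
  shows "(cmp C g h, c) \<in> elem_chains n" "chain_total (cmp C g h, c) = cmp C g (chain_total (h, c))"
  using assms by (cases c, auto simp: elem_chainsD intro!: elem_chainsI)+

lemma keys_translate_below:
  assumes "Poly_Mapping.keys c \<subseteq> chains_below n F" "g \<in> Mor C" "tgt C g = src C F"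
  shows "Poly_Mapping.keys (translate C g c) \<subseteq> chains_below n (cmp C g F)"
  unfolding translate_def
proof (rule keys_frag_extend_subset[OF assms(1)])
  fix p assume p: "p \<in> chains_below n F"
  obtain h c where hc: "p = (h, c)" by (cases p)
  then have "(h, c) \<in> elem_chains n" "left_divides C (chain_total (h, c)) F" "src C h = src C F"
    using p chains_below_src by (auto simp: chains_below_def)
  then show "Poly_Mapping.keys (case p of (h, s) \<Rightarrow> frag_of (cmp C g h, s))
      \<subseteq> chains_below n (cmp C g F)"
    using hc chain_total_cmp assms(2,3) left_divides_cmp by (auto simp: chains_below_def)
qed

text \<open>The basis of the value of \<open>chain_module\<close> at \<open>x\<close>, by
  \<open>val_chain_module\<close>.\<close>

definition chains_at :: "nat \<Rightarrow> 'o \<Rightarrow> ('m \<times> ('o, 'm) cell) set"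
  where "chains_at n x = {p \<in> elem_chains n. src C (fst p) = x}"

lemma chains_below_subset_at: "chains_below n F \<subseteq> chains_at n (src C F)"
  using chains_below_src by (fastforce simp: chains_at_def chains_below_def)

lemma src_chain_total: "p \<in> elem_chains n \<Longrightarrow> src C (chain_total p) = src C (fst p)"
  by (cases p) (auto simp: elem_chainsD)

lemma keys_translate_at:
  assumes "Poly_Mapping.keys c \<subseteq> chains_at n (tgt C g)" "g \<in> Mor C"
  shows "Poly_Mapping.keys (translate C g c) \<subseteq> chains_at n (src C g)"
  unfolding translate_def
proof (rule keys_frag_extend_subset[OF assms(1)])
  fix p assume "p \<in> chains_at n (tgt C g)"
  then show "Poly_Mapping.keys (case p of (h, s) \<Rightarrow> frag_of (cmp C g h, s)) \<subseteq> chains_at n (src C g)"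
    using chain_total_cmp(1) assms(2) by (cases p) (auto simp: chains_at_def elem_chainsD)
qed

lemma translate_translate:
  assumes "Poly_Mapping.keys c \<subseteq> chains_at n (tgt C g)" "f \<in> Mor C" "g \<in> Mor C" "tgt C f = src C g"
  shows "translate C f (translate C g c) = translate C (cmp C f g) c"
  unfolding translate_def frag_extend_frag_extend
  by (rule frag_extend_eq) (use assms in \<open>force simp: chains_at_def elem_chains_def\<close>)

section \<open>The recursion at one degree\<close>

definition reduces :: "nat \<Rightarrow> ('m \<times> ('o, 'm) cell \<Rightarrow> ('o, 'm) chain) \<Rightarrow> bool"
  where "reduces n r \<longleftrightarrow>
    (\<forall>p\<in>elem_chains n. Poly_Mapping.keys (r p) \<subseteq> irred_below n (chain_total p))"

text \<open>Linearity over the category is built in: the formula for the differential of a cell,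
  which belongs to an identity coefficient, is translated by \<open>f\<close>.\<close>

definition boundary_eq :: "nat \<Rightarrow> ('m \<times> ('o, 'm) cell \<Rightarrow> ('o, 'm) chain) \<Rightarrow>
    ('m \<times> ('o, 'm) cell \<Rightarrow> ('o, 'm) chain) \<Rightarrow> bool"
  where "boundary_eq n r d \<longleftrightarrow> (\<forall>f y a as. (f, (y, a # as)) \<in> elem_chains (Suc n) \<longrightarrow>
    d (f, (y, a # as)) = (let q = cell_quot C a (y, as) in
      translate C f (frag_of (q, (y, as)) - r (q, (y, as)))))"

text \<open>One degree of the recursion, with \<open>r\<close> as given data and all maps prescribed
  on elementary chains; \<open>frag_extend\<close> supplies the linear extension.\<close>

definition contraction_eq :: "nat \<Rightarrow> ('m \<times> ('o, 'm) cell \<Rightarrow> ('o, 'm) chain) \<Rightarrow>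
    ('m \<times> ('o, 'm) cell \<Rightarrow> ('o, 'm) chain) \<Rightarrow> bool"
  where "contraction_eq n r s \<longleftrightarrow> (\<forall>f y as. (f, (y, as)) \<in> elem_chains n \<longrightarrow>
    s (f, (y, as)) =
      (if irreducible (f, (y, as)) then 0
       else let a = md C A lt (chain_total (f, (y, as)));
                q = cell_quot C a (y, as);
                g = right_quot C f q
            in frag_of (g, (y, a # as)) + frag_extend s (translate C g (r (q, (y, as))))))"

text \<open>The chain \<open>q[A]\<close> has total \<open>lcm(a, A)\<close>; translating by
  \<open>f\<close> turns this bound into the total of \<open>f[a, A]\<close>.\<close>

lemma keys_reduces_step:
  assumes r: "reduces n r" and p: "(f, (y, a # as)) \<in> elem_chains (Suc n)"
  defines "q \<equiv> cell_quot C a (y, as)"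
  shows "Poly_Mapping.keys (translate C f (r (q, (y, as))))
    \<subseteq> chains_below n (chain_total (f, (y, a # as)))"
proof -
  have "Poly_Mapping.keys (r (q, (y, as))) \<subseteq> chains_below n (cell_lcm C (y, a # as))"
    using r chain_step_down[OF p] irred_below_subset unfolding reduces_def q_def by fastforce
  from keys_translate_below[OF this] show ?thesis
    using elem_chainsD[OF p] by simp
qed

text \<open>This makes the recursion for \<open>s\<close> terminate: a term of \<open>g r(\<alpha>\<^bsub>/A\<^esub>[A])\<close> of full total is
  irreducible since its first entry is \<open>\<alpha>\<close>, and \<open>\<alpha>\<close> is least for \<open>g lcm(\<alpha>, A)\<close> too.\<close>

lemma reduces_step_irreducible_or_smaller:
  assumes r: "reduces n r" and p: "(f, (y, a # as)) \<in> elem_chains (Suc n)"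
    and irr: "irreducible (f, (y, a # as))"
    and p': "p' \<in> Poly_Mapping.keys (translate C f (r (cell_quot C a (y, as), (y, as))))"
  shows "irreducible p' \<or> strictly_left_divides C (chain_total p') (chain_total (f, (y, a # as)))"
proof -
  define q where "q = cell_quot C a (y, as)"
  define m where "m = cell_lcm C (y, a # as)"
  note pD = elem_chainsD[OF p]
  have keys: "Poly_Mapping.keys (r (q, (y, as))) \<subseteq> irred_below n m"
    using r chain_step_down[OF p] unfolding reduces_def q_def m_def by fastforce
  obtain p0 where p0: "p0 \<in> Poly_Mapping.keys (r (q, (y, as)))"
    "p' \<in> Poly_Mapping.keys (case p0 of (h, s) \<Rightarrow> frag_of (cmp C f h, s))"
    using subsetD[OF keys_frag_extend p'[unfolded translate_def]] unfolding q_def by blast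
  obtain h z bs where "p0 = (h, (z, bs))" by (cases p0)
  with p0 keys have h: "(h, (z, bs)) \<in> irred_below n m" "p' = (cmp C f h, (z, bs))"
    by auto
  then have hm: "(h, (z, bs)) \<in> elem_chains n" "left_divides C (chain_total (h, (z, bs))) m"
    and hirr: "irreducible (h, (z, bs))" and hs: "src C h = tgt C f"
    using chains_below_src[of h "(z, bs)" n m] pD
    by (auto simp: irred_below_def chains_below_def m_def)
  have tot: "chain_total p' = cmp C f (chain_total (h, (z, bs)))"
    using h chain_total_cmp[OF hm(1)] pD hs by simp
  from hm(2) show ?thesis
  proof (cases rule: left_divides_cases)
    case 1
    have md: "md C A lt m = a"
      using pD(2) cell_lcm_Cons unfolding m_def by blast
    \<comment> \<open>An irreducible chain on an empty cell has an identity as total, whereas the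
      generator \<open>a\<close> right-divides \<open>m\<close>.\<close>
    have zbs: "bs \<noteq> []"
    proof
      assume "bs = []"
      then have "identity_mor C m"
        using hirr 1 is_cell_Obj[OF elem_chainsD(2)[OF hm(1)]] unfolding identity_mor_def
        by (auto simp: cell_lcm_Nil)
      moreover have "right_divides C a m" "a \<in> A"
        using pD(2) cell_lcm_Cons(1) unfolding m_def is_left_lcm_def
        by (auto simp: is_cell_Cons_iff)
      ultimately show False
        using not_identity_if_gen_right_divides by blast
    qed
    then have "hd bs = a"
      using hirr 1 md by simp
    then show ?thesis
      using zbs h tot 1 irr m_def by simp
  next
    case 2
    then show ?thesis
      using strictly_left_divides_cmp[OF 2, of f] tot pD by (simp add: m_def)
  qed
qed

text \<open>The leading term keeps the total by \<open>chain_step_down\<close>, and the terms of the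
  reduction stay below it by \<open>keys_reduces_step\<close>.\<close>

lemma keys_boundary:
  assumes r: "reduces n r" and d: "boundary_eq n r d" and p: "p \<in> elem_chains (Suc n)"
  shows "Poly_Mapping.keys (d p) \<subseteq> chains_below n (chain_total p)"
proof -
  obtain f y as' where p': "p = (f, (y, as'))" by (cases p)
  then obtain a as where as': "as' = a # as"
    using elem_chainsD(3)[of f y as' "Suc n"] p by (cases as') auto
  let ?q = "cell_quot C a (y, as)"
  have p2: "(f, (y, a # as)) \<in> elem_chains (Suc n)"
    using p p' as' by simp
  have "(cmp C f ?q, (y, as)) \<in> chains_below n (chain_total p)"
    using chains_belowI[OF chain_step_down(2)[OF p2]] chain_step_down(4)[OF p2] p' as' by simp
  moreover have "d p = frag_of (cmp C f ?q, (y, as)) - translate C f (r (?q, (y, as)))"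
    using d p2 p' as' by (simp add: boundary_eq_def Let_def translate_diff)
  ultimately show ?thesis
    using keys_reduces_step[OF r p2] p' as' by (simp add: keys_diff_subset)
qed

text \<open>Induction on the total. The new cell gives an irreducible chain of the same total; in
  the recursive argument irreducible terms contribute 0, and the remaining ones have smaller
  total.\<close>

lemma keys_contraction:
  assumes r: "reduces n r" and s: "contraction_eq n r s" and p: "p \<in> elem_chains n"
  shows "Poly_Mapping.keys (s p) \<subseteq> irred_below (Suc n) (chain_total p)"
  using p
proof (induction "chain_total p" arbitrary: p rule: wf_induct_rule[OF wf_strictly_left_divides])
  case (1 p)
  obtain f y as where p: "p = (f, (y, as))" by (cases p)
  show ?case
  proof (cases "irreducible p")
    case True
    then show ?thesis
      using s 1 p by (simp add: contraction_eq_def)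
  next
    case False
    define a where "a = md C A lt (chain_total p)"
    define q where "q = cell_quot C a (y, as)"
    define g where "g = right_quot C f q"
    have up: "(g, (y, a # as)) \<in> elem_chains (Suc n)" "irreducible (g, (y, a # as))"
      "chain_total (g, (y, a # as)) = chain_total p"
      using chain_step_up[of f y as n] 1(2) False p unfolding a_def q_def g_def by auto
    have sp: "s p = frag_of (g, (y, a # as)) + frag_extend s (translate C g (r (q, (y, as))))"
      using s 1 p False unfolding a_def q_def g_def by (auto simp: contraction_eq_def Let_def)
    have "Poly_Mapping.keys (frag_extend s (translate C g (r (q, (y, as)))))
      \<subseteq> irred_below (Suc n) (chain_total p)"
    proof (rule keys_frag_extend_subset[OF order_refl])
      fix p' assume p': "p' \<in> Poly_Mapping.keys (translate C g (r (q, (y, as))))"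
      then have "p' \<in> chains_below n (chain_total p)"
        using keys_reduces_step[OF r up(1)] up(3) q_def by auto
      then have e: "p' \<in> elem_chains n" and "left_divides C (chain_total p') (chain_total p)"
        by (auto simp: chains_below_def)
      moreover have "irreducible p' \<or> strictly_left_divides C (chain_total p') (chain_total p)"
        using reduces_step_irreducible_or_smaller[OF r up(1,2)] p' up(3) q_def by auto
      moreover have "s p' = 0" if "irreducible p'"
        using s e that by (cases p') (auto simp: contraction_eq_def)
      ultimately show "Poly_Mapping.keys (s p') \<subseteq> irred_below (Suc n) (chain_total p)"
        using 1(1)[of p'] irred_below_mono by fastforce
    qed
    moreover have "(g, (y, a # as)) \<in> irred_below (Suc n) (chain_total p)"
      using up chains_belowI[OF up(1)] by (simp add: irred_below_def)
    ultimately show ?thesis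
      unfolding sp by (intro keys_add_subset) auto
  qed
qed

text \<open>Neither the differential nor the contraction leaves the chains below a given total, and
  the contraction produces irreducible ones.\<close>

lemma reduces_Suc:
  assumes "reduces n r" "boundary_eq n r d" "contraction_eq n r s"
  shows "reduces (Suc n) (\<lambda>p. frag_extend s (d p))"
  unfolding reduces_def
proof
  fix p assume p: "p \<in> elem_chains (Suc n)"
  show "Poly_Mapping.keys (frag_extend s (d p)) \<subseteq> irred_below (Suc n) (chain_total p)"
  proof (rule keys_frag_extend_subset[OF keys_boundary[OF assms(1,2) p]])
    fix p' assume "p' \<in> chains_below n (chain_total p)"
    then show "Poly_Mapping.keys (s p') \<subseteq> irred_below (Suc n) (chain_total p)"
      using keys_contraction[OF assms(1,3), of p'] irred_below_mono
      by (fastforce simp: chains_below_def)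
  qed
qed

text \<open>This is \<open>r 0\<close>, the contraction of degree -1 after the augmentation: the
  augmentation is 1 on every elementary 0-chain, so only the source survives.\<close>

definition base_reduction :: "'m \<times> ('o, 'm) cell \<Rightarrow> ('o, 'm) chain"
  where "base_reduction p = frag_of (idt C (src C (fst p)), (src C (fst p), []))"

lemma base_chain:
  assumes "x \<in> Obj C"
  shows "(idt C x, (x, [])) \<in> elem_chains 0" "chain_total (idt C x, (x, [])) = idt C x"
  using assms by (auto simp: cell_lcm_Nil is_cell.simps intro!: elem_chainsI)

lemma reduces_0: "reduces 0 base_reduction"
  unfolding reduces_def
proof
  fix p assume p: "p \<in> elem_chains 0"
  obtain f y as where pp: "p = (f, (y, as))" by (cases p)
  let ?x = "src C f"
  have f: "f \<in> Mor C" "chain_total p \<in> Mor C" "src C (chain_total p) = ?x"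
    using elem_chainsD[of f y as 0] p pp by auto
  then have "left_divides C (idt C ?x) (chain_total p)"
    unfolding left_divides_def by (metis cmp_idt_left idt_in src_in tgt_idt)
  then show "Poly_Mapping.keys (base_reduction p) \<subseteq> irred_below 0 (chain_total p)"
    using f base_chain[of ?x] pp
    by (auto simp: base_reduction_def irred_below_def chains_below_def)
qed

section \<open>Solving the recursion\<close>

text \<open>Well-founded recursion on totals. The functional \<open>H\<close> recurs only on
  reducible chains of strictly smaller total; by \<open>reduces_step_irreducible_or_smaller\<close>
  all other terms are irreducible, so dropping them agrees with \<open>s\<close> being 0
  there.\<close>

lemma exists_contraction:
  assumes r: "reduces n r"
  shows "\<exists>s. contraction_eq n r s"
proof -
  define R where "R = {(p', p). strictly_left_divides C (chain_total p') (chain_total p)}"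
  have "wf R"
    using wf_inv_image[OF wf_strictly_left_divides, of chain_total]
    by (simp add: R_def inv_image_def)
  define H :: "('m \<times> ('o, 'm) cell \<Rightarrow> ('o, 'm) chain) \<Rightarrow> 'm \<times> ('o, 'm) cell \<Rightarrow> ('o, 'm) chain"
    where "H s p = (if irreducible p then 0
       else let (f, (y, as)) = p;
                a = md C A lt (chain_total p);
                q = cell_quot C a (y, as);
                g = right_quot C f q
            in frag_of (g, (y, a # as)) +
               frag_extend (\<lambda>p'. if (p', p) \<in> R \<and> \<not> irreducible p' then s p' else 0)
                 (translate C g (r (q, (y, as)))))" for s p
  define s where "s = wfrec R H"
  have s: "s p = H s p" for p
  proof -
    have "s p = H (cut s R p) p"
      using wfrec[OF \<open>wf R\<close>] unfolding s_def by metis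
    also have "\<dots> = H s p"
    proof -
      \<comment> \<open>\<open>cut\<close> changes \<open>s\<close> only outside \<open>R\<close>,
        where the guard in \<open>H\<close> returns 0 anyway.\<close>
      have "(\<lambda>p'. if (p', p) \<in> R \<and> \<not> irreducible p' then cut s R p p' else 0) =
          (\<lambda>p'. if (p', p) \<in> R \<and> \<not> irreducible p' then s p' else 0)"
        by (auto simp: cut_apply)
      then show ?thesis
        unfolding H_def by simp
    qed
    finally show ?thesis .
  qed
  have "contraction_eq n r s"
    unfolding contraction_eq_def
  proof (intro allI impI)
    fix f y as
    assume p: "(f, (y, as)) \<in> elem_chains n"
    show "s (f, (y, as)) = (if irreducible (f, (y, as)) then 0
       else let a = md C A lt (chain_total (f, (y, as)));
                q = cell_quot C a (y, as);
                g = right_quot C f q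
            in frag_of (g, (y, a # as)) + frag_extend s (translate C g (r (q, (y, as)))))"
    proof (cases "irreducible (f, (y, as))")
      case True
      then show ?thesis by (simp add: s[of "(f, (y, as))"] H_def)
    next
      case False
      define a where "a = md C A lt (chain_total (f, (y, as)))"
      define q where "q = cell_quot C a (y, as)"
      define g where "g = right_quot C f q"
      note up = chain_step_up[OF p False, folded a_def, folded q_def, folded g_def]
      have "frag_extend (\<lambda>p'. if (p', (f, (y, as))) \<in> R \<and> \<not> irreducible p' then s p' else 0)
          (translate C g (r (q, (y, as)))) = frag_extend s (translate C g (r (q, (y, as))))"
      proof (rule frag_extend_eq)
        fix p' assume p': "p' \<in> Poly_Mapping.keys (translate C g (r (q, (y, as))))"
        then have "irreducible p' \<or> (p', (f, (y, as))) \<in> R"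
          using reduces_step_irreducible_or_smaller[OF r up(1,2)] up(3)
          unfolding R_def q_def by auto
        moreover have "s p' = 0" if "irreducible p'"
          using that by (simp add: s[of p'] H_def)
        ultimately show "(if (p', (f, (y, as))) \<in> R \<and> \<not> irreducible p' then s p' else 0) = s p'"
          by auto
      qed
      then show ?thesis
        using False
        by (simp add: s[of "(f, (y, as))"] H_def Let_def a_def q_def g_def)
    qed
  qed
  then show ?thesis by blast
qed

end

section \<open>The complex on elementary chains\<close>

text \<open>The recursion in all degrees on elementary chains. It serves twice: a solution extends
  linearly to the required differentials, and every given solution restricts to an instance of
  it.\<close>

locale basis_complex = ordered_Gaussian C A lt
  for C :: "('o, 'm) small_cat" and A :: "'m set" and lt :: "'o \<Rightarrow> 'm rel" +
  fixes r d s :: "nat \<Rightarrow> 'm \<times> ('o, 'm) cell \<Rightarrow> ('o, 'm) chain"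
  assumes r_0: "r 0 = base_reduction"
    and r_Suc: "r (Suc n) = (\<lambda>p. frag_extend (s n) (d n p))"
    and boundary: "boundary_eq n (r n) (d n)"
    and contraction: "contraction_eq n (r n) (s n)"

context ordered_Gaussian
begin

lemma exists_basis_complex: "\<exists>r d s. basis_complex C A lt r d s"
proof -
  define dd :: "('m \<times> ('o, 'm) cell \<Rightarrow> ('o, 'm) chain) \<Rightarrow> 'm \<times> ('o, 'm) cell \<Rightarrow> ('o, 'm) chain"
    where "dd r = (\<lambda>(f, (y, as)). let q = cell_quot C (hd as) (y, tl as) in
      translate C f (frag_of (q, (y, tl as)) - r (q, (y, tl as))))" for r
  define ss where "ss n r = (SOME s. contraction_eq n r s)" for n r
  \<comment> \<open>In each degree \<open>dd\<close> and \<open>ss\<close> depend on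
    \<open>r\<close> alone, so the recursion runs over \<open>r\<close>. The choice in
    \<open>ss\<close> is justified only afterwards, when induction on the degree yields
    \<open>reduces n (r n)\<close>.\<close>
  define r where "r = rec_nat base_reduction (\<lambda>n r p. frag_extend (ss n r) (dd r p))"
  have r: "r 0 = base_reduction" "\<And>n. r (Suc n) = (\<lambda>p. frag_extend (ss n (r n)) (dd (r n) p))"
    by (simp_all add: r_def)
  have b: "boundary_eq n (r n) (dd (r n))" for n
    by (simp add: boundary_eq_def dd_def)
  have c: "contraction_eq n (r n) (ss n (r n))" if "reduces n (r n)" for n
    using someI_ex[OF exists_contraction[OF that]] unfolding ss_def .
  have "reduces n (r n)" for n
    by (induction n) (use r b c reduces_0 reduces_Suc in auto)
  then have "basis_complex C A lt r (\<lambda>n. dd (r n)) (\<lambda>n. ss n (r n))"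
    by unfold_locales (use r b c in auto)
  then show ?thesis by blast
qed

end

context basis_complex
begin

section \<open>Supports and linearity of the maps\<close>

lemma reduces: "reduces n (r n)"
  by (induction n) (use r_0 r_Suc boundary contraction reduces_0 reduces_Suc in auto)

lemma r_Suc_frag: "frag_extend (r (Suc n)) c = frag_extend (s n) (frag_extend (d n) c)"
  by (simp add: r_Suc frag_extend_frag_extend)

lemma d_eq:
  assumes "(f, (y, a # as)) \<in> elem_chains (Suc n)"
  shows "d n (f, (y, a # as)) = frag_of (cmp C f (cell_quot C a (y, as)), (y, as)) -
    translate C f (r n (cell_quot C a (y, as), (y, as)))"
  using boundary[of n] assms by (simp add: boundary_eq_def Let_def translate_diff)

lemma s_irreducible: "p \<in> elem_chains n \<Longrightarrow> irreducible p \<Longrightarrow> s n p = 0"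
  using contraction[of n] by (cases p) (auto simp: contraction_eq_def)

lemma elem_chains_Suc_cases:
  assumes "p \<in> elem_chains (Suc n)"
  obtains f y a as where "p = (f, (y, a # as))"
  using assms elem_chainsD(3)[of "fst p" "fst (snd p)" "snd (snd p)" "Suc n"]
  by (cases p; cases "snd (snd p)") auto

lemma below_subset_at:
  assumes "p \<in> chains_at m x"
  shows "chains_below n (chain_total p) \<subseteq> chains_at n x"
    and "irred_below n (chain_total p) \<subseteq> chains_at n x"
proof -
  have "src C (chain_total p) = x"
    using assms src_chain_total unfolding chains_at_def by blast
  then show "chains_below n (chain_total p) \<subseteq> chains_at n x"
    using chains_below_subset_at[of n "chain_total p"] by simp
  then show "irred_below n (chain_total p) \<subseteq> chains_at n x"
    using irred_below_subset by blast
qed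

lemma chains_at_subset: "chains_at n x \<subseteq> elem_chains n"
  by (auto simp: chains_at_def)

lemma keys_r_at:
  assumes "p \<in> chains_at n x"
  shows "Poly_Mapping.keys (r n p) \<subseteq> chains_at n x"
  using reduces[of n, unfolded reduces_def] below_subset_at(2)[OF assms] assms chains_at_subset
  by (meson order_trans subsetD)

lemma keys_d_at:
  assumes "p \<in> chains_at (Suc n) x"
  shows "Poly_Mapping.keys (d n p) \<subseteq> chains_at n x"
  using keys_boundary[OF reduces boundary] below_subset_at(1)[OF assms] assms chains_at_subset
  by (meson order_trans subsetD)

lemma keys_s_at:
  assumes "p \<in> chains_at n x"
  shows "Poly_Mapping.keys (s n p) \<subseteq> chains_at (Suc n) x"
  using keys_contraction[OF reduces contraction] below_subset_at(2)[OF assms] assms chains_at_subset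
  by (meson order_trans subsetD)

lemmas keys_d_frag = keys_frag_extend_subset[OF _ keys_d_at]
  and keys_s_frag = keys_frag_extend_subset[OF _ keys_s_at]

text \<open>\<open>boundary_eq\<close> involves the coefficient only through translation, and
  successive translations compose.\<close>

lemma d_translate:
  assumes "(h, c) \<in> elem_chains (Suc n)" "g \<in> Mor C" "tgt C g = src C h"
  shows "d n (cmp C g h, c) = translate C g (d n (h, c))"
proof -
  obtain y a as where c: "c = (y, a # as)"
    using assms(1) by (auto elim: elem_chains_Suc_cases)
  define q where "q = cell_quot C a (y, as)"
  have p: "(h, (y, a # as)) \<in> elem_chains (Suc n)" using assms c by simp
  have gp: "(cmp C g h, (y, a # as)) \<in> elem_chains (Suc n)"
    using chain_total_cmp(1)[OF p] assms by simp
  have h: "h \<in> Mor C" and q: "q \<in> Mor C" "tgt C h = src C q"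
    using elem_chainsD[OF p] cell_quot_in cell_quot_src unfolding q_def by auto
  have "(q, (y, as)) \<in> chains_at n (tgt C h)"
    using chain_step_down(1)[OF p] q by (simp add: chains_at_def q_def)
  then have "translate C g (translate C h (r n (q, (y, as)))) = translate C (cmp C g h) (r n (q, (y, as)))"
    using keys_r_at assms h by (intro translate_translate[where n = n]) blast+
  then show ?thesis
    using d_eq[OF p] d_eq[OF gp] c assms h q unfolding q_def[symmetric]
    by (simp add: translate_diff)
qed

lemma d_translate_frag:
  assumes "Poly_Mapping.keys c \<subseteq> chains_at (Suc n) (tgt C g)" "g \<in> Mor C"
  shows "frag_extend (d n) (translate C g c) = translate C g (frag_extend (d n) c)"
proof -
  have "translate C g c = frag_extend (\<lambda>p. frag_of (cmp C g (fst p), snd p)) c"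
    by (simp add: translate_def case_prod_unfold)
  then have "frag_extend (d n) (translate C g c) = frag_extend (\<lambda>p. d n (cmp C g (fst p), snd p)) c"
    by (simp add: frag_extend_frag_extend)
  also have "\<dots> = frag_extend (\<lambda>p. translate C g (d n p)) c"
  proof (rule frag_extend_eq)
    fix p assume "p \<in> Poly_Mapping.keys c"
    then have "(fst p, snd p) \<in> elem_chains (Suc n)" "tgt C g = src C (fst p)"
      using assms(1) by (auto simp: chains_at_def)
    then show "d n (cmp C g (fst p), snd p) = translate C g (d n p)"
      using d_translate assms(2) by (metis prod.collapse)
  qed
  finally show ?thesis
    by (simp add: translate_frag_extend)
qed

text \<open>In positive degree the leading term of \<open>d p\<close> is reducible and is paired
  with \<open>p\<close>, so its contraction is \<open>p\<close> plus the contraction of exactly the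
  term that \<open>d p\<close> subtracts; the two cancel. In degree 0 an irreducible chain is
  already the value of \<open>base_reduction\<close>.\<close>

lemma r_irreducible:
  assumes p: "p \<in> elem_chains n" and irr: "irreducible p"
  shows "r n p = frag_of p"
proof (cases n)
  case 0
  obtain f y as where "p = (f, (y, as))" by (cases p)
  moreover from this have "as = []" "y \<in> Obj C"
    using p 0 elem_chainsD[of f y as 0] is_cell_Obj by auto
  ultimately show ?thesis
    using irr 0 by (simp add: r_0 base_reduction_def)
next
  case (Suc m)
  then obtain f y a as where pp: "p = (f, (y, a # as))"
    using p elem_chains_Suc_cases by blast
  define q where "q = cell_quot C a (y, as)"
  have p': "(f, (y, a # as)) \<in> elem_chains (Suc m)" "irreducible (f, (y, a # as))"
    using p irr pp Suc by auto
  have fq: "(cmp C f q, (y, as)) \<in> elem_chains m" "\<not> irreducible (cmp C f q, (y, as))"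
    "chain_total (cmp C f q, (y, as)) = chain_total (f, (y, a # as))"
    using chain_step_down[OF p'(1)] irreducible_step_down[OF p'] by (simp_all add: q_def)
  have "right_quot C (cmp C f q) q = f"
    using elem_chainsD[OF p'(1)] cell_quot_in cell_quot_src
    by (intro right_quot_eq) (auto simp: q_def)
  moreover have "md C A lt (chain_total (f, (y, a # as))) = a"
    using p'(2) by simp
  ultimately have "s m (cmp C f q, (y, as)) =
      frag_of p + frag_extend (s m) (translate C f (r m (q, (y, as))))"
    using contraction[of m] fq pp unfolding contraction_eq_def Let_def
    by (simp del: chain_total.simps irreducible_chain.simps add: q_def)
  then show ?thesis
    using d_eq[OF p'(1)] pp Suc by (simp add: r_Suc frag_extend_diff q_def)
qed

section \<open>The contracting homotopy\<close>

text \<open>The hypothesis carried from degree to degree; it identifies the reduction of the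
  recursive argument of \<open>s\<close> with \<open>r n p\<close>.\<close>

definition translation_absorbing :: "nat \<Rightarrow> bool"
  where "translation_absorbing n \<longleftrightarrow>
    (\<forall>g h c. g \<in> Mor C \<longrightarrow> (h, c) \<in> elem_chains n \<longrightarrow> tgt C g = src C h \<longrightarrow>
      frag_extend (r n) (translate C g (r n (h, c))) = r n (cmp C g h, c))"

text \<open>For reducible \<open>p\<close>, the contraction is \<open>g[a, A]\<close> plus that of
  \<open>t\<close>. The boundary of \<open>g[a, A]\<close> is \<open>p - t\<close>; the terms of
  \<open>t\<close> are irreducible or smaller, so the second part contributes
  \<open>t - r t\<close>; and \<open>r t = r p\<close> by absorption, as \<open>g q = f\<close>. For
  irreducible \<open>p\<close> both sides vanish.\<close>

lemma homotopy_step: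
  assumes "translation_absorbing n" "p \<in> elem_chains n"
  shows "frag_extend (d n) (s n p) = frag_of p - r n p"
  using assms(2)
proof (induction "chain_total p" arbitrary: p rule: wf_induct_rule[OF wf_strictly_left_divides])
  case (1 p)
  show ?case
  proof (cases "irreducible p")
    case True
    then show ?thesis
      using 1 s_irreducible r_irreducible by simp
  next
    case False
    obtain f y as where p: "p = (f, (y, as))" by (cases p)
    define a where "a = md C A lt (chain_total (f, (y, as)))"
    define q where "q = cell_quot C a (y, as)"
    define g where "g = right_quot C f q"
    have p': "(f, (y, as)) \<in> elem_chains n" "\<not> irreducible (f, (y, as))"
      using p 1 False by auto
    note up = chain_step_up[OF p', folded a_def, folded q_def, folded g_def]
    define t where "t = translate C g (r n (q, (y, as)))"
    have "s n p = frag_of (g, (y, a # as)) + frag_extend (s n) t"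
      using contraction[of n] p' p unfolding contraction_eq_def Let_def
      by (simp del: chain_total.simps irreducible_chain.simps add: q_def a_def g_def t_def)
    moreover have "d n (g, (y, a # as)) = frag_of p - t"
      using d_eq[OF up(1)] up(4) p by (simp add: t_def q_def)
    moreover have "frag_extend (d n) (frag_extend (s n) t) = t - frag_extend (r n) t"
    proof -
      have "frag_extend (\<lambda>p. frag_extend (d n) (s n p)) t = frag_extend (\<lambda>p. frag_of p - r n p) t"
      proof (rule frag_extend_eq)
        fix p' assume p': "p' \<in> Poly_Mapping.keys t"
        have e: "p' \<in> elem_chains n"
          using keys_reduces_step[OF reduces up(1)] p' chains_below_subset
          by (auto simp: t_def q_def)
        have "irreducible p' \<or> strictly_left_divides C (chain_total p') (chain_total p)"
          using reduces_step_irreducible_or_smaller[OF reduces up(1,2)] p' up(3) p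
          by (auto simp: t_def q_def)
        then show "frag_extend (d n) (s n p') = frag_of p' - r n p'"
        proof
          assume "irreducible p'"
          then show ?thesis
            using e s_irreducible r_irreducible by (simp del: irreducible_chain.simps)
        next
          assume "strictly_left_divides C (chain_total p') (chain_total p)"
          then show ?thesis
            using 1(1)[of p'] e by blast
        qed
      qed
      then show ?thesis
        by (simp add: frag_extend_frag_extend frag_extend_diff_fun flip: frag_expansion)
    qed
    moreover have "frag_extend (r n) t = r n p"
    proof -
      have "g \<in> Mor C" "tgt C g = src C q" "(q, (y, as)) \<in> elem_chains n"
        using elem_chainsD[OF up(1)] cell_quot_src chain_step_down(1)[OF up(1)]
        by (auto simp: q_def)
      then show ?thesis
        using assms(1) up(4) p by (auto simp: translation_absorbing_def t_def)
    qed
    ultimately show ?thesis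
      by (simp add: frag_extend_add)
  qed
qed

text \<open>Absorption gives the two terms of \<open>d n p\<close> the same reduction.\<close>

lemma r_d_step:
  assumes "translation_absorbing n" "p \<in> elem_chains (Suc n)"
  shows "frag_extend (r n) (d n p) = 0"
proof -
  obtain f y a as where p: "p = (f, (y, a # as))"
    using assms(2) elem_chains_Suc_cases by blast
  define q where "q = cell_quot C a (y, as)"
  have p': "(f, (y, a # as)) \<in> elem_chains (Suc n)" using assms p by simp
  have "f \<in> Mor C" "tgt C f = src C q" "(q, (y, as)) \<in> elem_chains n"
    using elem_chainsD[OF p'] cell_quot_src chain_step_down(1)[OF p'] by (auto simp: q_def)
  then show ?thesis
    using assms(1) d_eq[OF p'] p by (simp add: translation_absorbing_def frag_extend_diff q_def)
qed

lemma frag_extend_homotopy_step: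
  assumes "translation_absorbing n" "Poly_Mapping.keys c \<subseteq> elem_chains n"
  shows "frag_extend (d n) (frag_extend (s n) c) = c - frag_extend (r n) c"
proof -
  have "frag_extend (\<lambda>p. frag_extend (d n) (s n p)) c = frag_extend (\<lambda>p. frag_of p - r n p) c"
    using homotopy_step[OF assms(1)] assms(2) by (intro frag_extend_eq) auto
  then show ?thesis
    by (simp add: frag_extend_frag_extend frag_extend_diff_fun flip: frag_expansion)
qed

lemma frag_extend_r_d_step:
  assumes "translation_absorbing n" "Poly_Mapping.keys c \<subseteq> elem_chains (Suc n)"
  shows "frag_extend (r n) (frag_extend (d n) c) = 0"
  unfolding frag_extend_frag_extend
  by (rule frag_extend_eq_0) (use r_d_step[OF assms(1)] assms(2) in blast)

text \<open>In degree 0 the reduction sees only the source. Upwards, the homotopy and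
  \<open>r d = 0\<close> give \<open>d s d = d\<close>; moving \<open>g\<close> through
  \<open>d\<close> yields
  \<open>s d (g s d p) = s (g d s d p) = s (g d p) = s d (g p)\<close>.\<close>

lemma translation_absorbing: "translation_absorbing n"
proof (induction n)
  case 0
  show ?case
    by (auto simp: translation_absorbing_def r_0 base_reduction_def elem_chains_def)
next
  case (Suc n)
  show ?case
    unfolding translation_absorbing_def
  proof (intro allI impI)
    fix g h c
    assume g: "g \<in> Mor C" "tgt C g = src C h" and h: "(h, c) \<in> elem_chains (Suc n)"
    let ?p = "(h, c)"
    let ?d = "frag_extend (d n)" and ?s = "frag_extend (s n)" and ?r = "frag_extend (r n)"
    have p: "?p \<in> chains_at (Suc n) (tgt C g)"
      using g h by (simp add: chains_at_def)
    note dp = keys_d_at[OF p]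
    note sdp = keys_s_frag[OF dp]
    have "?d (?s (d n ?p)) = d n ?p - ?r (d n ?p)"
      using frag_extend_homotopy_step[OF Suc] dp chains_at_subset by blast
    also have "\<dots> = d n ?p"
      using r_d_step[OF Suc h] by simp
    finally have "?d (?s (d n ?p)) = d n ?p" .
    then show "frag_extend (r (Suc n)) (translate C g (r (Suc n) ?p)) = r (Suc n) (cmp C g h, c)"
      unfolding r_Suc_frag using d_translate_frag[OF sdp g(1)] d_translate[OF h g]
      by (simp add: r_Suc)
  qed
qed

lemmas homotopy = frag_extend_homotopy_step[OF translation_absorbing]
  and r_d = frag_extend_r_d_step[OF translation_absorbing]

text \<open>Vanishing of \<open>r (Suc n)\<close> on boundaries says \<open>s d d = 0\<close>, the
  degrees being understood. Applying \<open>d\<close> and using \<open>d s d = d\<close> leaves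
  \<open>d d = 0\<close>.\<close>

lemma d_d:
  assumes "Poly_Mapping.keys c \<subseteq> elem_chains (Suc (Suc n))"
  shows "frag_extend (d n) (frag_extend (d (Suc n)) c) = 0"
  unfolding frag_extend_frag_extend
proof (rule frag_extend_eq_0)
  fix p assume "p \<in> Poly_Mapping.keys c"
  then have "p \<in> elem_chains (Suc (Suc n))" using assms by auto
  moreover obtain x where "x = src C (fst p)" by simp
  ultimately have p: "p \<in> chains_at (Suc (Suc n)) x" by (simp add: chains_at_def)
  let ?c = "d (Suc n) p"
  have k: "Poly_Mapping.keys ?c \<subseteq> chains_at (Suc n) x"
    using keys_d_at[OF p] .
  have "frag_extend (r (Suc n)) ?c = 0"
    using r_d[of "frag_of p" "Suc n"] p chains_at_subset by auto
  then have "frag_extend (d n) (frag_extend (s n) (frag_extend (d n) ?c)) = 0"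
    by (simp add: r_Suc_frag)
  moreover have "frag_extend (d n) (frag_extend (s n) (frag_extend (d n) ?c)) = frag_extend (d n) ?c"
    using homotopy[of "frag_extend (d n) ?c" n] r_d[of ?c n] keys_d_frag[OF k] k chains_at_subset
    by fastforce
  ultimately show "frag_extend (d n) ?c = 0" by simp
qed

end

section \<open>Free modules\<close>

lemma hom_free_diff:
  assumes "\<phi> \<in> hom (free_Abelian_group S) (free_Abelian_group T)"
    "Poly_Mapping.keys a \<subseteq> S" "Poly_Mapping.keys b \<subseteq> S"
  shows "\<phi> (a - b) = \<phi> a - \<phi> b"
proof -
  have "\<phi> ((a - b) + b) = \<phi> (a - b) + \<phi> b"
    using hom_mult[OF assms(1), of "a - b" b] assms(2,3) by (simp add: keys_diff_subset)
  then show ?thesis by (simp add: algebra_simps)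
qed

lemma hom_free_zero:
  assumes "\<phi> \<in> hom (free_Abelian_group S) (free_Abelian_group T)"
  shows "\<phi> 0 = 0"
  using hom_free_diff[OF assms, of 0 0] by simp

lemma hom_free_eq_frag_extend:
  assumes "\<phi> \<in> hom (free_Abelian_group S) (free_Abelian_group T)" "Poly_Mapping.keys c \<subseteq> S"
  shows "\<phi> c = frag_extend (\<lambda>p. \<phi> (frag_of p)) c"
proof -
  \<comment> \<open>The support bound is part of the induction statement because the difference case
    needs it for both \<open>a\<close> and \<open>b\<close>.\<close>
  have "Poly_Mapping.keys c \<subseteq> S \<and> \<phi> c = frag_extend (\<lambda>p. \<phi> (frag_of p)) c"
    using assms(2)
  proof (induction c rule: frag_induction)
    case (diff a b)
    then show ?case
      using hom_free_diff[OF assms(1)] keys_diff_subset by (metis frag_extend_diff)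
  qed (use hom_free_zero[OF assms(1)] in auto)
  then show ?thesis by blast
qed

lemma frag_extend_hom:
  assumes "\<And>p. p \<in> S \<Longrightarrow> Poly_Mapping.keys (f p) \<subseteq> T"
  shows "frag_extend f \<in> hom (free_Abelian_group S) (free_Abelian_group T)"
  by (auto simp: hom_def frag_extend_add dest: subsetD[OF keys_frag_extend_subset[OF _ assms]])

section \<open>Free modules over a category\<close>

lemma val_free_module:
  "val (free_module C S) x =
    free_Abelian_group {(g, s). g \<in> Mor C \<and> src C g = x \<and> s \<in> S (tgt C g)}"
  and act_free_module: "act (free_module C S) f = translate C f"
  by (simp_all add: free_module_def translate_def)

lemma translate_eq: "translate C g = frag_extend (\<lambda>p. frag_of (cmp C g (fst p), snd p))"
  by (simp add: translate_def case_prod_unfold)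

lemma is_cat_module_free_module:
  assumes "category C"
  shows "is_cat_module C (free_module C S)"
proof -
  interpret category C by fact
  show ?thesis
    unfolding is_cat_module_def val_free_module act_free_module
  proof (intro conjI ballI impI)
    show "comm_group (free_Abelian_group {(g, s). g \<in> Mor C \<and> src C g = x \<and> s \<in> S (tgt C g)})" for x
      by (rule abelian_free_Abelian_group)
    show "translate C f \<in> hom
        (free_Abelian_group {(g, s). g \<in> Mor C \<and> src C g = tgt C f \<and> s \<in> S (tgt C g)})
        (free_Abelian_group {(g, s). g \<in> Mor C \<and> src C g = src C f \<and> s \<in> S (tgt C g)})"
      if "f \<in> Mor C" for f
      unfolding translate_def by (rule frag_extend_hom) (use that in \<open>auto simp: cmp_in src_cmp tgt_cmp\<close>)
    show "translate C (idt C x) a = a"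
      if "x \<in> Obj C" "a \<in> carrier
        (free_Abelian_group {(g, s). g \<in> Mor C \<and> src C g = x \<and> s \<in> S (tgt C g)})" for x a
      unfolding translate_def
      by (rule frag_extend_frag_of_id) (use that in \<open>auto simp: cmp_idt_left dest!: subsetD\<close>)
    show "translate C (cmp C f g) a = translate C f (translate C g a)"
      if "f \<in> Mor C" "g \<in> Mor C" "tgt C f = src C g" "a \<in> carrier
        (free_Abelian_group {(h, s). h \<in> Mor C \<and> src C h = tgt C g \<and> s \<in> S (tgt C h)})" for f g a
      unfolding translate_eq frag_extend_frag_extend
      by (rule frag_extend_eq) (use that in \<open>auto simp: cmp_assoc dest!: subsetD\<close>)
  qed
qed

text \<open>\<open>is_free_module\<close> asks for a basis of module elements, so each
  \<open>s\<close> in \<open>T x\<close> is replaced by the element \<open>1 s\<close>. Then \<phi>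
  evaluates a formal translate \<open>g (1 s)\<close> to \<open>g s\<close>, and \<psi> undoes
  this.\<close>

lemma is_free_module_free_module:
  fixes C :: "('o, 'm) small_cat" and T :: "'o \<Rightarrow> 's set"
  assumes "category C"
  shows "is_free_module C (free_module C T)"
proof -
  interpret category C by fact
  let ?e = "\<lambda>x c. frag_of (idt C x, c)"
  let ?S = "\<lambda>x. ?e x ` T x"
  let ?BS = "\<lambda>x. {(g, t). g \<in> Mor C \<and> src C g = x \<and> t \<in> ?S (tgt C g)}"
  let ?BT = "\<lambda>x. {(g, t). g \<in> Mor C \<and> src C g = x \<and> t \<in> T (tgt C g)}"
  define \<phi> where "\<phi> = frag_extend (\<lambda>p. translate C (fst p) (snd p :: 'm \<times> 's \<Rightarrow>\<^sub>0 int))"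
  define \<psi> where "\<psi> = frag_extend (\<lambda>p. frag_of (fst p, ?e (tgt C (fst p)) (snd p :: 's)))"
  have e: "translate C g (?e (tgt C g) c) = frag_of (g, c)" if "g \<in> Mor C" for g and c :: 's
    using that by (simp add: cmp_idt_right)
  have \<phi>_hom: "\<phi> \<in> hom (free_Abelian_group (?BS x)) (free_Abelian_group (?BT x))" for x
    unfolding \<phi>_def by (rule frag_extend_hom) (auto simp: e simp del: translate_of)
  have \<psi>_hom: "\<psi> \<in> hom (free_Abelian_group (?BT x)) (free_Abelian_group (?BS x))" for x
    unfolding \<psi>_def by (rule frag_extend_hom) auto
  have "module_iso C (free_module C ?S) (free_module C T) (\<lambda>x. \<phi>)"
    unfolding module_iso_def module_hom_def val_free_module act_free_module
  proof (intro conjI ballI)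
    show "\<phi> \<in> hom (free_Abelian_group (?BS x)) (free_Abelian_group (?BT x))" for x
      by (rule \<phi>_hom)
    show "\<phi> (translate C f a) = translate C f (\<phi> a)"
      if f: "f \<in> Mor C" and a: "a \<in> carrier (free_Abelian_group (?BS (tgt C f)))" for f a
      unfolding \<phi>_def translate_frag_extend
      unfolding translate_eq[of C f, where ?'b = "'m \<times> 's \<Rightarrow>\<^sub>0 int"] frag_extend_frag_extend
    proof (rule frag_extend_eq)
      fix p assume "p \<in> Poly_Mapping.keys a"
      then obtain g c where p: "p = (g, ?e (tgt C g) c)" "g \<in> Mor C" "src C g = tgt C f"
        using a by (auto dest!: subsetD)
      then have "translate C (cmp C f g) (?e (tgt C g) c) = frag_of (cmp C f g, c)"
        using e[of "cmp C f g" c] f by (simp add: tgt_cmp cmp_in del: translate_of)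
      then show "frag_extend (\<lambda>p. translate C (fst p) (snd p)) (frag_of (cmp C f (fst p), snd p)) =
          translate C f (translate C (fst p) (snd p))"
        using p e[of g c] by (simp del: translate_of) simp
    qed
    show "bij_betw \<phi> (carrier (free_Abelian_group (?BS x))) (carrier (free_Abelian_group (?BT x)))" for x
    proof (rule bij_betw_byWitness[where f' = \<psi>])
      show "\<forall>a\<in>carrier (free_Abelian_group (?BS x)). \<psi> (\<phi> a) = a"
      proof
        fix a assume a: "a \<in> carrier (free_Abelian_group (?BS x))"
        show "\<psi> (\<phi> a) = a"
          unfolding \<psi>_def \<phi>_def frag_extend_frag_extend
          by (rule frag_extend_frag_of_id)
            (use a e in \<open>auto simp del: translate_of dest!: subsetD\<close>)
      qed
      show "\<forall>a\<in>carrier (free_Abelian_group (?BT x)). \<phi> (\<psi> a) = a"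
      proof
        fix a assume a: "a \<in> carrier (free_Abelian_group (?BT x))"
        show "\<phi> (\<psi> a) = a"
          unfolding \<psi>_def \<phi>_def frag_extend_frag_extend
          by (rule frag_extend_frag_of_id)
            (use a e in \<open>auto simp del: translate_of dest!: subsetD\<close>)
      qed
    qed (fact hom_carrier[OF \<phi>_hom] hom_carrier[OF \<psi>_hom])+
  qed
  then show ?thesis
    unfolding is_free_module_def by blast
qed


lemma hom_integer_group_eq:
  assumes "h \<in> hom integer_group integer_group" "h 1 = (1::int)"
  shows "h k = k"
proof -
  have add: "h (a + b) = h a + h b" for a b
    using assms(1) by (simp add: hom_def)
  show ?thesis
  proof (induction k rule: int_induct[of _ 0])
    case base
    show ?case using add[of 0 0] by simp
  next
    case (step1 i)
    then show ?case using add[of i 1] assms(2) by simp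
  next
    case (step2 i)
    then show ?case using add[of "i - 1" 1] assms(2) by simp
  qed
qed

section \<open>The Dehornoy--Lafont complex\<close>

context ordered_Gaussian
begin

lemma val_chain_module: "val (chain_module C A lt n) x = free_Abelian_group (chains_at n x)"
  unfolding chain_module_def val_free_module
  by (rule arg_cong[of _ _ free_Abelian_group]) (auto simp: chains_at_def elem_chains_def)

lemma act_chain_module: "act (chain_module C A lt n) f = translate C f"
  by (simp add: chain_module_def act_free_module)

lemma frag_of_id_cell: "(f, c) \<in> elem_chains n \<Longrightarrow> frag_of (f, c) = translate C f (frag_of (idt C (tgt C f), c))"
  by (simp add: elem_chains_def)

lemma id_cell_at:
  "(f, c) \<in> elem_chains n \<Longrightarrow> (idt C (tgt C f), c) \<in> chains_at n (tgt C f)"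
  by (simp add: elem_chains_def chains_at_def)

lemma hom_chainsI:
  assumes "\<And>p. p \<in> chains_at m x \<Longrightarrow> Poly_Mapping.keys (f p) \<subseteq> chains_at n y"
  shows "frag_extend f \<in> hom (val (chain_module C A lt m) x) (val (chain_module C A lt n) y)"
  unfolding val_chain_module using assms by (rule frag_extend_hom)

end

section \<open>Existence of the differentials by linear extension\<close>

context basis_complex
begin

text \<open>The sum of the coefficients, obtained by mapping the whole basis to a single
  generator.\<close>

definition augmentation :: "('o, 'm) chain \<Rightarrow> int"
  where "augmentation c = Poly_Mapping.lookup (frag_extend (\<lambda>_. frag_of ()) c) ()"

lemma augmentation_add: "augmentation (a + b) = augmentation a + augmentation b"
  and augmentation_diff: "augmentation (a - b) = augmentation a - augmentation b"
  and augmentation_zero: "augmentation 0 = 0"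
  and augmentation_of: "augmentation (frag_of p) = 1"
  by (simp_all add: augmentation_def frag_extend_add frag_extend_diff lookup_add lookup_minus)

lemma augmentation_translate: "augmentation (translate C g c) = augmentation c"
  by (simp add: augmentation_def translate_eq frag_extend_frag_extend)

lemma is_DL_differential:
  "is_DL_differential C A lt (\<lambda>x. augmentation) (\<lambda>n x. frag_extend (d n))
    (\<lambda>x k. frag_cmul k (frag_of (idt C x, (x, [])))) (\<lambda>n x. frag_extend (s n))"
proof -
  let ?\<epsilon> = "\<lambda>x::'o. augmentation" and ?sm = "\<lambda>x k. frag_cmul k (frag_of (idt C x, (x, [])))"
  let ?d = "\<lambda>n (x::'o). frag_extend (d n)" and ?s = "\<lambda>n (x::'o). frag_extend (s n)"
  \<comment> \<open>Identifies the \<open>reduction\<close> built from these maps with the linear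
    extension of \<open>r n\<close>; in degree 0 both send each elementary chain to the empty cell
    at \<open>x\<close>.\<close>
  have red: "reduction ?\<epsilon> ?d ?sm ?s n x c = frag_extend (r n) c"
    if "Poly_Mapping.keys c \<subseteq> chains_at n x" for n x c
  proof (cases n)
    case 0
    have "?sm x (augmentation c) = frag_extend base_reduction c"
      using that[unfolded 0]
    proof (induction c rule: frag_induction)
      case (one p)
      then show ?case
        by (auto simp: augmentation_of base_reduction_def chains_at_def)
    qed (auto simp: augmentation_zero augmentation_diff frag_cmul_diff_distrib frag_extend_diff)
    with 0 show ?thesis by (simp add: r_0)
  next
    case (Suc m)
    then show ?thesis by (simp add: r_Suc_frag)
  qed
  show ?thesis
    unfolding is_DL_differential_def Let_def module_hom_def act_chain_module
  proof (intro conjI allI ballI impI)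
    show "augmentation \<in> hom (val (chain_module C A lt 0) x) (val trivial_module x)" for x
      by (simp add: hom_def val_chain_module trivial_module_def augmentation_add)
    show "augmentation (translate C f a) = act trivial_module f (augmentation a)" for f a
      by (simp add: trivial_module_def augmentation_translate)
    show "frag_extend (d n) \<in> hom (val (chain_module C A lt (Suc n)) x) (val (chain_module C A lt n) x)" for n x
      using keys_d_at by (rule hom_chainsI)
    show "frag_extend (s n) \<in> hom (val (chain_module C A lt n) x) (val (chain_module C A lt (Suc n)) x)" for n x
      using keys_s_at by (rule hom_chainsI)
    show "frag_extend (d n) (translate C f a) = translate C f (frag_extend (d n) a)"
      if "f \<in> Mor C" "a \<in> carrier (val (chain_module C A lt (Suc n)) (tgt C f))" for n f a
      using that by (intro d_translate_frag) (auto simp: val_chain_module)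
    show "?sm x \<in> hom integer_group (val (chain_module C A lt 0) x)" if "x \<in> Obj C" for x
      using that base_chain(1)[OF that] by (auto simp: hom_def val_chain_module frag_cmul_distrib chains_at_def)
    show "augmentation (frag_of (idt C x, x, [])) = 1" for x
      by (rule augmentation_of)
    show "frag_cmul 1 (frag_of (idt C x, x, [])) = frag_of (idt C x, x, [])" for x
      by simp
    show "frag_extend (d n) (frag_of (idt C x, y, a # as)) =
        frag_of (cell_quot C a (y, as), y, as) -
        reduction ?\<epsilon> ?d ?sm ?s n x (frag_of (cell_quot C a (y, as), y, as))"
      if x: "x \<in> Obj C" and c: "(y, a # as) \<in> cells C A lt (Suc n) x" for n x y a as
    proof -
      let ?q = "cell_quot C a (y, as)"
      have p: "(idt C x, (y, a # as)) \<in> elem_chains (Suc n)"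
        using x c by (simp add: elem_chains_def)
      note pD = elem_chainsD[OF p]
      have q: "(?q, (y, as)) \<in> chains_at n x" "?q \<in> Mor C" "src C ?q = x"
        using chain_step_down(1)[OF p] cell_quot_src[OF pD(2)] cell_quot_in[OF pD(2)] pD(6) x
        by (auto simp: chains_at_def)
      \<comment> \<open>\<open>d_eq\<close> at a cell with identity coefficient leaves a translation
        by that identity.\<close>
      have "translate C (idt C x) b = b" if "Poly_Mapping.keys b \<subseteq> chains_at n x" for b
        unfolding translate_eq
        by (rule frag_extend_frag_of_id)
          (use that in \<open>auto simp: chains_at_def elem_chains_def dest!: subsetD\<close>)
      then show ?thesis
        using red[of "frag_of (?q, (y, as))" n x] d_eq[OF p] q keys_r_at[OF q(1)] by auto
    qed
    show "frag_extend (s n) (frag_of (f, y, as)) =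
        (if irreducible_chain C A lt f (y, as) then 0
         else frag_of (right_quot C f (cell_quot C (md C A lt (cmp C f (cell_lcm C (y, as)))) (y, as)),
                y, md C A lt (cmp C f (cell_lcm C (y, as))) # as) +
              frag_extend (s n) (translate C
                (right_quot C f (cell_quot C (md C A lt (cmp C f (cell_lcm C (y, as)))) (y, as)))
                (reduction ?\<epsilon> ?d ?sm ?s n
                  (src C (cell_quot C (md C A lt (cmp C f (cell_lcm C (y, as)))) (y, as)))
                  (frag_of (cell_quot C (md C A lt (cmp C f (cell_lcm C (y, as)))) (y, as), y, as)))))"
      if f: "f \<in> Mor C" and c: "(y, as) \<in> cells C A lt n (tgt C f)" for n f y as
    proof -
      have p: "(f, (y, as)) \<in> elem_chains n"
        using f c by (simp add: elem_chains_def)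
      show ?thesis
      proof (cases "irreducible (f, (y, as))")
        case True
        then show ?thesis
          using s_irreducible[OF p] by simp
      next
        case False
        define a where "a = md C A lt (chain_total (f, (y, as)))"
        define q where "q = cell_quot C a (y, as)"
        note up = chain_step_up[OF p False, folded a_def, folded q_def]
        have "(q, (y, as)) \<in> chains_at n (src C q)"
          using chain_step_down(1)[OF up(1)] by (simp add: q_def chains_at_def)
        then have "reduction ?\<epsilon> ?d ?sm ?s n (src C q) (frag_of (q, (y, as))) = r n (q, (y, as))"
          using red[of "frag_of (q, (y, as))"] by simp
        then show ?thesis
          using contraction[of n] p False unfolding contraction_eq_def Let_def
          by (simp del: irreducible_chain.simps add: q_def a_def)
      qed
    qed
  qed
qed

end

section \<open>Arbitrary solutions of the defining equations\<close>

locale DL_complex = ordered_Gaussian C A lt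
  for C :: "('o, 'm) small_cat" and A :: "'m set" and lt :: "'o \<Rightarrow> 'm rel" +
  fixes \<epsilon> d sm s
  assumes DL: "is_DL_differential C A lt \<epsilon> d sm s"
begin

lemma
  shows \<epsilon>_module_hom: "module_hom C (chain_module C A lt 0) trivial_module \<epsilon>"
    and d_module_hom: "module_hom C (chain_module C A lt (Suc n)) (chain_module C A lt n) (d n)"
    and sm_hom: "x \<in> Obj C \<Longrightarrow> sm x \<in> hom integer_group (free_Abelian_group (chains_at 0 x))"
    and s_hom: "x \<in> Obj C \<Longrightarrow>
      s n x \<in> hom (free_Abelian_group (chains_at n x)) (free_Abelian_group (chains_at (Suc n) x))"
    and \<epsilon>_unit: "x \<in> Obj C \<Longrightarrow> \<epsilon> x (frag_of (idt C x, (x, []))) = 1"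
    and sm_1: "x \<in> Obj C \<Longrightarrow> sm x 1 = frag_of (idt C x, (x, []))"
  using DL by (simp_all add: is_DL_differential_def Let_def val_chain_module)

lemma d_cell:
  assumes "x \<in> Obj C" "(y, a # as) \<in> cells C A lt (Suc n) x"
  shows "d n x (frag_of (idt C x, (y, a # as))) = frag_of (cell_quot C a (y, as), (y, as)) -
    reduction \<epsilon> d sm s n x (frag_of (cell_quot C a (y, as), (y, as)))"
  using DL assms unfolding is_DL_differential_def Let_def by blast

lemma s_chain:
  assumes "(f, (y, as)) \<in> elem_chains n" "\<not> irreducible (f, (y, as))"
  defines "a \<equiv> md C A lt (chain_total (f, (y, as)))"
  defines "q \<equiv> cell_quot C a (y, as)"
  defines "g \<equiv> right_quot C f q"
  shows "s n (src C f) (frag_of (f, (y, as))) = frag_of (g, (y, a # as)) +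
    s n (src C f) (translate C g (reduction \<epsilon> d sm s n (src C q) (frag_of (q, (y, as)))))"
  using DL assms(1,2) unfolding is_DL_differential_def Let_def act_chain_module a_def q_def g_def
  by (simp add: elem_chains_def del: irreducible_chain.simps)

lemma s_irreducible_chain:
  assumes "(f, (y, as)) \<in> elem_chains n" "irreducible (f, (y, as))"
  shows "s n (src C f) (frag_of (f, (y, as))) = 0"
  using DL assms unfolding is_DL_differential_def Let_def
  by (simp add: elem_chains_def del: irreducible_chain.simps)

lemma \<epsilon>_hom: "x \<in> Obj C \<Longrightarrow> \<epsilon> x \<in> hom (free_Abelian_group (chains_at 0 x)) integer_group"
  using \<epsilon>_module_hom by (simp add: module_hom_def val_chain_module trivial_module_def)

lemma d_hom: "x \<in> Obj C \<Longrightarrow>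
    d n x \<in> hom (free_Abelian_group (chains_at (Suc n) x)) (free_Abelian_group (chains_at n x))"
  using d_module_hom by (simp add: module_hom_def val_chain_module)

lemma r_hom: "x \<in> Obj C \<Longrightarrow>
    reduction \<epsilon> d sm s n x \<in> hom (free_Abelian_group (chains_at n x)) (free_Abelian_group (chains_at n x))"
proof (cases n)
  case 0
  have "reduction \<epsilon> d sm s 0 x = sm x \<circ> \<epsilon> x" by auto
  then show "x \<in> Obj C \<Longrightarrow> ?thesis"
    using 0 hom_compose[OF \<epsilon>_hom[of x] sm_hom[of x]] by simp
next
  case (Suc m)
  have "reduction \<epsilon> d sm s (Suc m) x = s m x \<circ> d m x" by auto
  then show "x \<in> Obj C \<Longrightarrow> ?thesis"
    using Suc hom_compose[OF d_hom[of x m] s_hom[of x m]] by simp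
qed

text \<open>By naturality the value at a 0-chain \<open>f[]\<close> is the value at the identity
  chain, since \<open>f\<close> acts trivially on the integers.\<close>

lemma \<epsilon>_chain:
  assumes "p \<in> chains_at 0 x"
  shows "\<epsilon> x (frag_of p) = 1"
proof -
  obtain f y as where p: "p = (f, (y, as))" by (cases p)
  then have e: "(f, (y, as)) \<in> elem_chains 0" "src C f = x"
    using assms by (auto simp: chains_at_def)
  note pD = elem_chainsD[OF e(1)]
  have "y \<in> Obj C" "as = []" "tgt C f = y"
    using pD is_cell_Obj by (auto simp: cell_lcm_Nil)
  moreover have "\<epsilon> (src C f) (translate C f (frag_of (idt C (tgt C f), (y, as)))) =
      \<epsilon> (tgt C f) (frag_of (idt C (tgt C f), (y, as)))"
    using \<epsilon>_module_hom pD(1) id_cell_at[OF e(1)] unfolding module_hom_def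
    by (simp add: trivial_module_def val_chain_module act_chain_module del: translate_of)
  ultimately show ?thesis
    using p e \<epsilon>_unit[of y] frag_of_id_cell[OF e(1)] by simp
qed

text \<open>The components at all objects are merged into one function on elementary chains, each
  chain being evaluated at its own source.\<close>

definition d_basis where "d_basis n p = d n (src C (fst p)) (frag_of p)"

definition s_basis where "s_basis n p = s n (src C (fst p)) (frag_of p)"

text \<open>Defined by recursion so that the equations for \<open>r\<close> in
  \<open>basis_complex\<close> hold outright; \<open>r_eq_basis\<close> identifies it with
  \<open>reduction\<close>.\<close>

definition r_basis where
  "r_basis = rec_nat base_reduction (\<lambda>n _ p. frag_extend (s_basis n) (d_basis n p))"

lemma r_basis_simps: "r_basis 0 = base_reduction"
  "r_basis (Suc n) = (\<lambda>p. frag_extend (s_basis n) (d_basis n p))"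
  by (simp_all add: r_basis_def)

lemma d_eq_frag_extend:
  assumes "x \<in> Obj C" "Poly_Mapping.keys c \<subseteq> chains_at (Suc n) x"
  shows "d n x c = frag_extend (d_basis n) c"
  unfolding hom_free_eq_frag_extend[OF d_hom[OF assms(1)] assms(2)]
  by (rule frag_extend_eq) (use assms(2) in \<open>auto simp: d_basis_def chains_at_def\<close>)

lemma s_eq_frag_extend:
  assumes "x \<in> Obj C" "Poly_Mapping.keys c \<subseteq> chains_at n x"
  shows "s n x c = frag_extend (s_basis n) c"
  unfolding hom_free_eq_frag_extend[OF s_hom[OF assms(1)] assms(2)]
  by (rule frag_extend_eq) (use assms(2) in \<open>auto simp: s_basis_def chains_at_def\<close>)

lemma keys_d:
  assumes "x \<in> Obj C" "Poly_Mapping.keys c \<subseteq> chains_at (Suc n) x"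
  shows "Poly_Mapping.keys (d n x c) \<subseteq> chains_at n x"
  using hom_in_carrier[OF d_hom[OF assms(1)], of c n] assms(2) by simp

lemma keys_r:
  assumes "x \<in> Obj C" "Poly_Mapping.keys c \<subseteq> chains_at n x"
  shows "Poly_Mapping.keys (reduction \<epsilon> d sm s n x c) \<subseteq> chains_at n x"
  using hom_in_carrier[OF r_hom[OF assms(1)], of c n] assms(2) by simp

lemma r_eq_basis:
  assumes "x \<in> Obj C" "p \<in> chains_at n x"
  shows "reduction \<epsilon> d sm s n x (frag_of p) = r_basis n p"
proof (cases n)
  case 0
  then show ?thesis
    using assms \<epsilon>_chain[of p x] sm_1[of x] by (auto simp: r_basis_simps base_reduction_def chains_at_def)
next
  case (Suc m)
  have "d m x (frag_of p) = d_basis m p"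
    using assms by (simp add: d_basis_def chains_at_def)
  then show ?thesis
    using Suc assms s_eq_frag_extend[OF assms(1) keys_d, of "frag_of p" m]
    by (simp add: r_basis_simps)
qed

sublocale basis: basis_complex C A lt r_basis d_basis s_basis
proof
  show "r_basis 0 = base_reduction" "r_basis (Suc n) = (\<lambda>p. frag_extend (s_basis n) (d_basis n p))" for n
    by (rule r_basis_simps)+
  show "boundary_eq n (r_basis n) (d_basis n)" for n
    unfolding boundary_eq_def Let_def
  proof (intro allI impI)
    fix f y a as
    assume p: "(f, (y, a # as)) \<in> elem_chains (Suc n)"
    let ?q = "cell_quot C a (y, as)" and ?c = "frag_of (idt C (tgt C f), (y, a # as))"
    note pD = elem_chainsD[OF p]
    have "(?q, (y, as)) \<in> chains_at n (tgt C f)"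
      using chain_step_down(1)[OF p] cell_quot_src[OF pD(2)] pD by (simp add: chains_at_def)
    then have r: "reduction \<epsilon> d sm s n (tgt C f) (frag_of (?q, (y, as))) = r_basis n (?q, (y, as))"
      using r_eq_basis pD by simp
    have "d_basis n (f, (y, a # as)) = d n (src C f) (translate C f ?c)"
      unfolding d_basis_def frag_of_id_cell[OF p, symmetric] by simp
    \<comment> \<open>Naturality reduces the differential of \<open>f[a, A]\<close> to that of the
      cell itself, where \<open>d_cell\<close> applies.\<close>
    also have "\<dots> = translate C f (d n (tgt C f) ?c)"
      using d_module_hom[of n] pD(1) id_cell_at[OF p] unfolding module_hom_def
      by (simp add: val_chain_module act_chain_module del: translate_of)
    also have "\<dots> = translate C f (frag_of (?q, (y, as)) - r_basis n (?q, (y, as)))"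
      using d_cell[of "tgt C f" y a as n] p pD(1) r by (simp add: elem_chains_def)
    finally show "d_basis n (f, (y, a # as)) =
      translate C f (frag_of (?q, (y, as)) - r_basis n (?q, (y, as)))" .
  qed
  show "contraction_eq n (r_basis n) (s_basis n)" for n
    unfolding contraction_eq_def
  proof (intro allI impI)
    fix f y as
    assume p: "(f, (y, as)) \<in> elem_chains n"
    show "s_basis n (f, (y, as)) = (if irreducible (f, (y, as)) then 0
       else let a = md C A lt (chain_total (f, (y, as)));
                q = cell_quot C a (y, as);
                g = right_quot C f q
            in frag_of (g, (y, a # as)) +
               frag_extend (s_basis n) (translate C g (r_basis n (q, (y, as)))))"
    proof (cases "irreducible (f, (y, as))")
      case True
      then show ?thesis
        using s_irreducible_chain[OF p] by (simp add: s_basis_def)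
    next
      case False
      define a where "a = md C A lt (chain_total (f, (y, as)))"
      define q where "q = cell_quot C a (y, as)"
      define g where "g = right_quot C f q"
      note up = chain_step_up[OF p False, folded a_def, folded q_def, folded g_def]
      note gD = elem_chainsD[OF up(1)]
      have q: "(q, (y, as)) \<in> chains_at n (src C q)" "src C q = tgt C g" "src C q \<in> Obj C"
        using chain_step_down(1)[OF up(1)] cell_quot_src[OF gD(2)] gD(6) tgt_in[OF gD(1)]
        by (auto simp: q_def chains_at_def)
      have k: "Poly_Mapping.keys (r_basis n (q, (y, as))) \<subseteq> chains_at n (tgt C g)"
        using keys_r[OF q(3), of "frag_of (q, (y, as))" n] r_eq_basis[OF q(3,1)] q by simp
      \<comment> \<open>The recursive term is evaluated at the source of \<open>f\<close>, while its
        support is known at the source of \<open>g\<close>.\<close>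
      have "src C f = src C g"
        using up(4) q gD cell_quot_in[OF gD(2)] by (metis q_def src_cmp)
      then have "s n (src C f) (translate C g (r_basis n (q, (y, as)))) =
          frag_extend (s_basis n) (translate C g (r_basis n (q, (y, as))))"
        using s_eq_frag_extend keys_translate_at[OF k gD(1)] gD(1) by simp
      then show ?thesis
        using s_chain[OF p False, folded a_def, folded q_def, folded g_def] r_eq_basis[OF q(3,1)] False
        by (simp del: irreducible_chain.simps chain_total.simps
            add: s_basis_def Let_def flip: a_def q_def g_def)
    qed
  qed
qed

section \<open>Exactness\<close>

lemma \<epsilon>_sm: "x \<in> Obj C \<Longrightarrow> \<epsilon> x (sm x k) = k"
  using hom_integer_group_eq[OF hom_compose[OF sm_hom \<epsilon>_hom], of x k] sm_1 \<epsilon>_unit by simp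

lemma r_eq_frag_extend:
  assumes "x \<in> Obj C" "Poly_Mapping.keys c \<subseteq> chains_at n x"
  shows "reduction \<epsilon> d sm s n x c = frag_extend (r_basis n) c"
  unfolding hom_free_eq_frag_extend[OF r_hom[OF assms(1)] assms(2)]
  by (rule frag_extend_eq) (use assms r_eq_basis in auto)

text \<open>The reduction of degree 0 is \<open>sm x\<close> after \<open>\<epsilon> x\<close>, and
  \<open>sm x\<close> is injective by \<open>\<epsilon>_sm\<close>. This lets the augmentation be
  treated like a differential.\<close>

lemma \<epsilon>_eq_0_iff:
  assumes "x \<in> Obj C" "Poly_Mapping.keys c \<subseteq> chains_at 0 x"
  shows "\<epsilon> x c = 0 \<longleftrightarrow> frag_extend (r_basis 0) c = 0"
proof -
  have r: "sm x (\<epsilon> x c) = frag_extend (r_basis 0) c"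
    using r_eq_frag_extend[OF assms] by simp
  have "\<epsilon> x 0 = 0" "sm x 0 = 0"
    using hom_one[OF \<epsilon>_hom] hom_one[OF sm_hom] assms(1) by auto
  then show ?thesis
    using r \<epsilon>_sm[OF assms(1)] by metis
qed

text \<open>Here \<phi> stands for the next map down, the augmentation or a differential. If \<phi>
  kills \<open>c\<close>, then so does the reduction, and the homotopy shows that \<open>c\<close>
  is the boundary of its contraction.\<close>

lemma exact:
  fixes \<phi> :: "('o, 'm) chain \<Rightarrow> 'c::zero"
  assumes x: "x \<in> Obj C"
    and \<phi>:  "\<And>c. Poly_Mapping.keys c \<subseteq> chains_at n x \<Longrightarrow> \<phi> c = 0 \<Longrightarrow> frag_extend (r_basis n) c = 0"
    and z: "\<And>c. Poly_Mapping.keys c \<subseteq> chains_at (Suc n) x \<Longrightarrow> \<phi> (frag_extend (d_basis n) c) = 0"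
  shows "d n x ` {c. Poly_Mapping.keys c \<subseteq> chains_at (Suc n) x} =
    {c. Poly_Mapping.keys c \<subseteq> chains_at n x \<and> \<phi> c = 0}"
proof (intro equalityI subsetI)
  fix b assume "b \<in> d n x ` {c. Poly_Mapping.keys c \<subseteq> chains_at (Suc n) x}"
  then obtain c where c: "b = d n x c" "Poly_Mapping.keys c \<subseteq> chains_at (Suc n) x"
    by blast
  then show "b \<in> {c. Poly_Mapping.keys c \<subseteq> chains_at n x \<and> \<phi> c = 0}"
    using d_eq_frag_extend[OF x c(2)] keys_d[OF x c(2)] z[OF c(2)] by simp
next
  fix c assume "c \<in> {c. Poly_Mapping.keys c \<subseteq> chains_at n x \<and> \<phi> c = 0}"
  then have c: "Poly_Mapping.keys c \<subseteq> chains_at n x" "frag_extend (r_basis n) c = 0"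
    using \<phi> by auto
  then have k: "Poly_Mapping.keys (frag_extend (s_basis n) c) \<subseteq> chains_at (Suc n) x"
    by (intro basis.keys_s_frag)
  have "d n x (frag_extend (s_basis n) c) = c"
    using basis.homotopy[OF order_trans[OF c(1) basis.chains_at_subset]] c(2)
      d_eq_frag_extend[OF x k] by simp
  then show "c \<in> d n x ` {c. Poly_Mapping.keys c \<subseteq> chains_at (Suc n) x}"
    using k by (metis (mono_tags, lifting) image_eqI mem_Collect_eq)
qed

lemma carrier_chain_module:
  "carrier (val (chain_module C A lt n) x) = {c. Poly_Mapping.keys c \<subseteq> chains_at n x}"
  by (auto simp: val_chain_module)

lemma free_resolution: "free_resolution C trivial_module (chain_module C A lt) \<epsilon> d"
  unfolding free_resolution_def
proof (intro conjI allI ballI)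
  show "is_cat_module C trivial_module"
    by (simp add: is_cat_module_def trivial_module_def abelian_integer_group hom_def)
  show "is_cat_module C (chain_module C A lt n)" "is_free_module C (chain_module C A lt n)" for n
    unfolding chain_module_def
    using is_cat_module_free_module is_free_module_free_module category_axioms by blast+
  show "module_hom C (chain_module C A lt 0) trivial_module \<epsilon>"
    by (rule \<epsilon>_module_hom)
  show "module_hom C (chain_module C A lt (Suc n)) (chain_module C A lt n) (d n)" for n
    by (rule d_module_hom)
  fix x assume x: "x \<in> Obj C"
  have "k \<in> \<epsilon> x ` carrier (val (chain_module C A lt 0) x)" for k
    by (rule image_eqI[of _ _ "sm x k"])
      (use hom_in_carrier[OF sm_hom[OF x], of k] \<epsilon>_sm[OF x] in \<open>auto simp: val_chain_module\<close>)
  then have "\<epsilon> x ` carrier (val (chain_module C A lt 0) x) = UNIV"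
    by blast
  then show "\<epsilon> x ` carrier (val (chain_module C A lt 0) x) = carrier (val trivial_module x)"
    by (simp add: trivial_module_def)
  have kd: "Poly_Mapping.keys (frag_extend (d_basis n) c) \<subseteq> chains_at n x"
    if "Poly_Mapping.keys c \<subseteq> chains_at (Suc n) x" for n c
    using that by (intro basis.keys_d_frag)
  have "d 0 x ` {c. Poly_Mapping.keys c \<subseteq> chains_at (Suc 0) x} =
      {c. Poly_Mapping.keys c \<subseteq> chains_at 0 x \<and> \<epsilon> x c = 0}"
  proof (rule exact[OF x])
    fix c :: "('o, 'm) chain"
    assume "Poly_Mapping.keys c \<subseteq> chains_at 0 x" "\<epsilon> x c = 0"
    then show "frag_extend (r_basis 0) c = 0"
      using \<epsilon>_eq_0_iff[OF x] by blast
  next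
    fix c :: "('o, 'm) chain"
    assume c: "Poly_Mapping.keys c \<subseteq> chains_at (Suc 0) x"
    then show "\<epsilon> x (frag_extend (d_basis 0) c) = 0"
      using \<epsilon>_eq_0_iff[OF x kd[OF c]] basis.r_d[OF order_trans[OF c basis.chains_at_subset]]
      by simp
  qed
  then show "d 0 x ` carrier (val (chain_module C A lt (Suc 0)) x) =
      kernel (val (chain_module C A lt 0) x) (val trivial_module x) (\<epsilon> x)"
    by (simp add: carrier_chain_module kernel_def trivial_module_def)
  show "d (Suc n) x ` carrier (val (chain_module C A lt (Suc (Suc n))) x) =
      kernel (val (chain_module C A lt (Suc n)) x) (val (chain_module C A lt n) x) (d n x)" for n
  proof -
    have "d (Suc n) x ` {c. Poly_Mapping.keys c \<subseteq> chains_at (Suc (Suc n)) x} =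
        {c. Poly_Mapping.keys c \<subseteq> chains_at (Suc n) x \<and> d n x c = 0}"
    proof (rule exact[OF x])
      fix c :: "('o, 'm) chain"
      assume "Poly_Mapping.keys c \<subseteq> chains_at (Suc n) x" "d n x c = 0"
      \<comment> \<open>In positive degree the reduction applies the differential first, so it kills
        cycles.\<close>
      then show "frag_extend (r_basis (Suc n)) c = 0"
        using d_eq_frag_extend[OF x] by (simp add: basis.r_Suc_frag)
    next
      fix c :: "('o, 'm) chain"
      assume c: "Poly_Mapping.keys c \<subseteq> chains_at (Suc (Suc n)) x"
      then show "d n x (frag_extend (d_basis (Suc n)) c) = 0"
        using d_eq_frag_extend[OF x kd[OF c]]
          basis.d_d[OF order_trans[OF c basis.chains_at_subset]] by simp
    qed
    then show ?thesis
      by (simp add: carrier_chain_module kernel_def val_chain_module[of n])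
  qed
qed

end

theorem proposition2p15:
  fixes C :: "('o, 'm) small_cat" and A :: "'m set" and lt :: "'o \<Rightarrow> 'm rel"
  assumes "category C"
    and "\<forall>f. invertible_mor C f \<longrightarrow> identity_mor C f"
    and "locally_left_Gaussian C"
    and "ordered_generators C A lt"
  shows "(\<exists>\<epsilon> d sm s. is_DL_differential C A lt \<epsilon> d sm s) \<and>
    (\<forall>\<epsilon> d sm s. is_DL_differential C A lt \<epsilon> d sm s \<longrightarrow>
       free_resolution C trivial_module (chain_module C A lt) \<epsilon> d)"
proof -
  interpret ordered_Gaussian C A lt
    using assms by (simp add: ordered_Gaussian_def ordered_Gaussian_axioms_def)
  obtain r d s where "basis_complex C A lt r d s"
    using exists_basis_complex by blast
  then have "\<exists>\<epsilon> d sm s. is_DL_differential C A lt \<epsilon> d sm s"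
    using basis_complex.is_DL_differential by blast
  moreover have "free_resolution C trivial_module (chain_module C A lt) \<epsilon> d"
    if "is_DL_differential C A lt \<epsilon> d sm s" for \<epsilon> d sm s
  proof -
    interpret DL_complex C A lt \<epsilon> d sm s
      by unfold_locales (rule that)
    show ?thesis by (rule free_resolution)
  qed
  ultimately show ?thesis by blast
qed

end
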